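(* Let $(B^n,g_B)$ be a Riemannian manifold with scalar curvature $S_B$, $(F^d,g_F)$ a semi-Riemannian manifold with constant scalar curvature $\lambda_F$, $f$ a positive smooth function on $B$, $h\in C^\infty(B)$ and $\widetilde h=h\circ\pi$. Suppose the warped product $\overline M^{n+d}=(B\times F,\overline g)$, $\overline g=\pi^*g_B+(f\circ\pi)^2\sigma^*g_F$, is a gradient Yamabe soliton with potential function $\widetilde h$ and soliton constant $\rho$, and that $S_B\ge \rho-\frac{\lambda_F}{f^2}$ on $B$. If $f$ attains its maximum on $B$, then $\overline M^{n+d}$ is a standard semi-Riemannian product, i.e. $f$ is constant.
   Context: Manifolds are connected. $\pi:B\times F\to B$ and $\sigma:B\times F\to F$ are the projections. A semi-Riemannian manifold $(M,g)$ is a gradient Yamabe soliton with potential function $u\in C^\infty(M)$ and soliton constant $\rho\in\mathbb R$ if $(S_g-\rho)g=\mathrm{Hess}_g(u)$, where $S_g$ is the scalar curvature of $g$. *)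

theory Defs
  imports "HOL-Analysis.Analysis"
begin

section \<open>Smooth maps between open subsets of Euclidean spaces\<close>

text \<open>The set \<open>S\<close> is always open below, so derivatives are taken with respect to \<open>at x\<close>.\<close>

primrec Ck_on :: "nat \<Rightarrow> 'a::real_normed_vector set \<Rightarrow> ('a \<Rightarrow> 'b::real_normed_vector) \<Rightarrow> bool" where
  "Ck_on 0 S f \<longleftrightarrow> continuous_on S f"
| "Ck_on (Suc k) S f \<longleftrightarrow>
     (\<forall>x\<in>S. f differentiable (at x)) \<and> (\<forall>v. Ck_on k S (\<lambda>x. frechet_derivative f (at x) v))"

definition smooth_on :: "'a::real_normed_vector set \<Rightarrow> ('a \<Rightarrow> 'b::real_normed_vector) \<Rightarrow> bool" where
  "smooth_on S f \<longleftrightarrow> (\<forall>k. Ck_on k S f)"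

section \<open>Smooth manifolds\<close>

text \<open>
  The points of a manifold form a type \<open>'m\<close>; charts take values in a Euclidean space \<open>'e\<close>,
  and the dimension of the manifold is \<open>DIM('e)\<close>.  The smooth structure is given by an
  atlas, which need not be maximal.
\<close>

type_synonym ('m, 'e) chart = "'m set \<times> ('m \<Rightarrow> 'e)"

definition chart_dom :: "('m, 'e) chart \<Rightarrow> 'm set" where
  "chart_dom c = fst c"

definition chart_map :: "('m, 'e) chart \<Rightarrow> 'm \<Rightarrow> 'e" where
  "chart_map c = snd c"

definition chart_img :: "('m, 'e) chart \<Rightarrow> 'e set" where
  "chart_img c = chart_map c ` chart_dom c"

definition chart_inv :: "('m, 'e) chart \<Rightarrow> 'e \<Rightarrow> 'm" where
  "chart_inv c = inv_into (chart_dom c) (chart_map c)"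

definition smooth_atlas ::
  "('m::topological_space, 'e::euclidean_space) chart set \<Rightarrow> bool" where
  "smooth_atlas A \<longleftrightarrow>
     (\<Union>c\<in>A. chart_dom c) = UNIV \<and>
     (\<forall>c\<in>A. open (chart_dom c) \<and> open (chart_img c) \<and>
            homeomorphism (chart_dom c) (chart_img c) (chart_map c) (chart_inv c)) \<and>
     (\<forall>c\<in>A. \<forall>c'\<in>A. smooth_on (chart_map c ` (chart_dom c \<inter> chart_dom c'))
                             (chart_map c' \<circ> chart_inv c))"

definition smooth_manifold ::
  "('m::{t2_space,second_countable_topology}, 'e::euclidean_space) chart set \<Rightarrow> bool" where
  "smooth_manifold A \<longleftrightarrow> smooth_atlas A \<and> connected (UNIV :: 'm set)"

definition smooth_fun_on ::
  "('m::topological_space, 'e::euclidean_space) chart set \<Rightarrow> 'm set \<Rightarrow> ('m \<Rightarrow> real) \<Rightarrow> bool" where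
  "smooth_fun_on A W k \<longleftrightarrow>
     (\<forall>c\<in>A. smooth_on (chart_map c ` (W \<inter> chart_dom c)) (k \<circ> chart_inv c))"

abbreviation smooth_fun ::
  "('m::topological_space, 'e::euclidean_space) chart set \<Rightarrow> ('m \<Rightarrow> real) \<Rightarrow> bool" where
  "smooth_fun A k \<equiv> smooth_fun_on A UNIV k"

definition smooth_near ::
  "('m::topological_space, 'e::euclidean_space) chart set \<Rightarrow> 'm \<Rightarrow> ('m \<Rightarrow> real) \<Rightarrow> bool" where
  "smooth_near A p k \<longleftrightarrow> (\<exists>W. open W \<and> p \<in> W \<and> smooth_fun_on A W k)"

definition product_chart :: "('m, 'e) chart \<Rightarrow> ('n, 'f) chart \<Rightarrow> ('m \<times> 'n, 'e \<times> 'f) chart" where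
  "product_chart c c' = (chart_dom c \<times> chart_dom c', map_prod (chart_map c) (chart_map c'))"

definition product_atlas ::
  "('m, 'e) chart set \<Rightarrow> ('n, 'f) chart set \<Rightarrow> ('m \<times> 'n, 'e \<times> 'f) chart set" where
  "product_atlas A A' = {product_chart c c' | c c'. c \<in> A \<and> c' \<in> A'}"

section \<open>Tangent vectors and covariant 2-tensors\<close>

text \<open>
  A tangent vector at \<open>p\<close> acts as a derivation on the functions that are smooth near \<open>p\<close>
  (and is \<open>0\<close>, by convention, on all other functions).  The vector \<open>coord_vector A c p v\<close> is the
  derivation \<open>\<Sum>i. v\<^sub>i \<partial>/\<partial>x\<^sub>i\<close> at \<open>p\<close> in the coordinates of the chart \<open>c\<close>; when \<open>p\<close> lies
  in the domain of \<open>c\<close>, the map \<open>v \<mapsto> coord_vector A c p v\<close> is the usual linear isomorphism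
  from \<open>'e\<close> onto the tangent space at \<open>p\<close>.
\<close>

type_synonym 'm tangent = "('m \<Rightarrow> real) \<Rightarrow> real"

type_synonym 'm tensor2 = "'m \<Rightarrow> 'm tangent \<Rightarrow> 'm tangent \<Rightarrow> real"

definition coord_vector ::
  "('m::topological_space, 'e::euclidean_space) chart set \<Rightarrow> ('m, 'e) chart \<Rightarrow> 'm \<Rightarrow> 'e \<Rightarrow> 'm tangent"
where
  "coord_vector A c p v =
     (\<lambda>k. if smooth_near A p k
          then frechet_derivative (k \<circ> chart_inv c) (at (chart_map c p)) v else 0)"

definition coord_form ::
  "('m::topological_space, 'e::euclidean_space) chart set \<Rightarrow> ('m, 'e) chart \<Rightarrow> 'm tensor2 \<Rightarrow>
     'e \<Rightarrow> 'e \<Rightarrow> 'e \<Rightarrow> real" where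
  "coord_form A c g x v w =
     g (chart_inv c x) (coord_vector A c (chart_inv c x) v) (coord_vector A c (chart_inv c x) w)"

definition pushforward ::
  "('n::topological_space, 'f::euclidean_space) chart set \<Rightarrow> ('m \<Rightarrow> 'n) \<Rightarrow> 'm \<Rightarrow> 'm tangent \<Rightarrow> 'n tangent"
where
  "pushforward A' \<Phi> p X = (\<lambda>k. if smooth_near A' (\<Phi> p) k then X (k \<circ> \<Phi>) else 0)"

definition pullback ::
  "('n::topological_space, 'f::euclidean_space) chart set \<Rightarrow> ('m \<Rightarrow> 'n) \<Rightarrow> 'n tensor2 \<Rightarrow> 'm tensor2"
where
  "pullback A' \<Phi> g = (\<lambda>p X Y. g (\<Phi> p) (pushforward A' \<Phi> p X) (pushforward A' \<Phi> p Y))"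

section \<open>Semi-Riemannian metrics\<close>

definition nondegenerate :: "('e::euclidean_space \<Rightarrow> 'e \<Rightarrow> real) \<Rightarrow> bool" where
  "nondegenerate G \<longleftrightarrow> (\<forall>v. (\<forall>w. G v w = 0) \<longrightarrow> v = 0)"

definition form_index :: "('e::euclidean_space \<Rightarrow> 'e \<Rightarrow> real) \<Rightarrow> nat" where
  "form_index G = Max {dim V | V. subspace V \<and> (\<forall>v\<in>V. v \<noteq> 0 \<longrightarrow> G v v < 0)}"

definition semi_riemannian_metric ::
  "('m::topological_space, 'e::euclidean_space) chart set \<Rightarrow> 'm tensor2 \<Rightarrow> bool" where
  "semi_riemannian_metric A g \<longleftrightarrow>
     (\<forall>c\<in>A. \<forall>v w. smooth_on (chart_img c) (\<lambda>x. coord_form A c g x v w)) \<and>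
     (\<forall>c\<in>A. \<forall>x\<in>chart_img c.
        bilinear (coord_form A c g x) \<and>
        (\<forall>v w. coord_form A c g x v w = coord_form A c g x w v) \<and>
        nondegenerate (coord_form A c g x)) \<and>
     (\<exists>\<nu>. \<forall>c\<in>A. \<forall>x\<in>chart_img c. form_index (coord_form A c g x) = \<nu>)"

definition semi_riemannian_manifold ::
  "('m::{t2_space,second_countable_topology}, 'e::euclidean_space) chart set \<Rightarrow> 'm tensor2 \<Rightarrow> bool"
where
  "semi_riemannian_manifold A g \<longleftrightarrow> smooth_manifold A \<and> semi_riemannian_metric A g"

definition riemannian_manifold ::
  "('m::{t2_space,second_countable_topology}, 'e::euclidean_space) chart set \<Rightarrow> 'm tensor2 \<Rightarrow> bool"
where
  "riemannian_manifold A g \<longleftrightarrow> semi_riemannian_manifold A g \<and>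
     (\<forall>c\<in>A. \<forall>x\<in>chart_img c. \<forall>v. v \<noteq> 0 \<longrightarrow> coord_form A c g x v v > 0)"

section \<open>Curvature and Hessian\<close>

text \<open>
  In the following definitions \<open>G x\<close> is the expression of a metric in a chart, and \<open>u v w\<close> are
  constant coordinate vector fields.  The curvature convention is
  \<open>R(X,Y)Z = \<nabla>\<^sub>X \<nabla>\<^sub>Y Z - \<nabla>\<^sub>Y \<nabla>\<^sub>X Z - \<nabla>\<^sub>[\<^sub>X\<^sub>,\<^sub>Y\<^sub>] Z\<close>, and \<open>Ric(Y,Z)\<close> is the trace of \<open>X \<mapsto> R(X,Y)Z\<close>.
  \<open>Basis\<close> only provides the coordinate directions; its Euclidean inner product is not used as a
  metric.
\<close>

definition sharp :: "('e::euclidean_space \<Rightarrow> 'e \<Rightarrow> real) \<Rightarrow> ('e \<Rightarrow> real) \<Rightarrow> 'e" where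
  "sharp G \<alpha> = (THE z. \<forall>w. G z w = \<alpha> w)"

text \<open>
  \<open>christoffel G x v w\<close> is \<open>\<nabla>\<^sub>v w\<close>, given by the Koszul formula; its \<open>k\<close>-th component is
  \<open>\<Sum>i j. \<Gamma>\<^sup>k\<^sub>i\<^sub>j v\<^sub>i w\<^sub>j\<close>.
\<close>

definition christoffel :: "('e::euclidean_space \<Rightarrow> 'e \<Rightarrow> 'e \<Rightarrow> real) \<Rightarrow> 'e \<Rightarrow> 'e \<Rightarrow> 'e \<Rightarrow> 'e" where
  "christoffel G x v w = sharp (G x) (\<lambda>z.
     (frechet_derivative (\<lambda>y. G y w z) (at x) v
      + frechet_derivative (\<lambda>y. G y v z) (at x) w
      - frechet_derivative (\<lambda>y. G y v w) (at x) z) / 2)"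

definition riemann :: "('e::euclidean_space \<Rightarrow> 'e \<Rightarrow> 'e \<Rightarrow> real) \<Rightarrow> 'e \<Rightarrow> 'e \<Rightarrow> 'e \<Rightarrow> 'e \<Rightarrow> 'e" where
  "riemann G x u v w =
     frechet_derivative (\<lambda>y. christoffel G y v w) (at x) u
     - frechet_derivative (\<lambda>y. christoffel G y u w) (at x) v
     + christoffel G x u (christoffel G x v w)
     - christoffel G x v (christoffel G x u w)"

definition ricci :: "('e::euclidean_space \<Rightarrow> 'e \<Rightarrow> 'e \<Rightarrow> real) \<Rightarrow> 'e \<Rightarrow> 'e \<Rightarrow> 'e \<Rightarrow> real" where
  "ricci G x v w = (\<Sum>i\<in>Basis. riemann G x i v w \<bullet> i)"

definition inverse_metric :: "('e::euclidean_space \<Rightarrow> 'e \<Rightarrow> real) \<Rightarrow> 'e \<Rightarrow> 'e \<Rightarrow> real" where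
  "inverse_metric G i j = sharp G (\<lambda>w. w \<bullet> i) \<bullet> j"

definition scalar_curv :: "('e::euclidean_space \<Rightarrow> 'e \<Rightarrow> 'e \<Rightarrow> real) \<Rightarrow> 'e \<Rightarrow> real" where
  "scalar_curv G x = (\<Sum>i\<in>Basis. \<Sum>j\<in>Basis. inverse_metric (G x) i j * ricci G x i j)"

definition hess :: "('e::euclidean_space \<Rightarrow> 'e \<Rightarrow> 'e \<Rightarrow> real) \<Rightarrow> ('e \<Rightarrow> real) \<Rightarrow> 'e \<Rightarrow> 'e \<Rightarrow> 'e \<Rightarrow> real" where
  "hess G u x v w =
     frechet_derivative (\<lambda>y. frechet_derivative u (at y) w) (at x) v
     - frechet_derivative u (at x) (christoffel G x v w)"

text \<open>
  \<open>has_scalar_curvature A g S\<close>: the function \<open>S\<close> is the scalar curvature of \<open>g\<close>; likewise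
  \<open>has_hessian A g u H\<close>: the tensor field \<open>H\<close> is the Hessian of \<open>u\<close> with respect to \<open>g\<close>.
  By the coordinate invariance of the two classical expressions such an \<open>S\<close> always exists, as does
  such an \<open>H\<close>; as the charts cover the manifold, \<open>S\<close> is unique, and \<open>H\<close> is unique on tangent
  vectors.
\<close>

definition has_scalar_curvature ::
  "('m::topological_space, 'e::euclidean_space) chart set \<Rightarrow> 'm tensor2 \<Rightarrow> ('m \<Rightarrow> real) \<Rightarrow> bool" where
  "has_scalar_curvature A g S \<longleftrightarrow>
     (\<forall>c\<in>A. \<forall>p\<in>chart_dom c. S p = scalar_curv (coord_form A c g) (chart_map c p))"

definition has_hessian ::
  "('m::topological_space, 'e::euclidean_space) chart set \<Rightarrow> 'm tensor2 \<Rightarrow> ('m \<Rightarrow> real) \<Rightarrow>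
     'm tensor2 \<Rightarrow> bool" where
  "has_hessian A g u H \<longleftrightarrow>
     (\<forall>c\<in>A. \<forall>p\<in>chart_dom c. \<forall>v w. H p (coord_vector A c p v) (coord_vector A c p w) =
        hess (coord_form A c g) (u \<circ> chart_inv c) (chart_map c p) v w)"

section \<open>Gradient Yamabe solitons and warped products\<close>

definition gradient_yamabe_soliton ::
  "('m::{t2_space,second_countable_topology}, 'e::euclidean_space) chart set \<Rightarrow> 'm tensor2 \<Rightarrow>
     ('m \<Rightarrow> real) \<Rightarrow> real \<Rightarrow> bool" where
  "gradient_yamabe_soliton A g u \<rho> \<longleftrightarrow>
     semi_riemannian_manifold A g \<and> smooth_fun A u \<and>
     (\<exists>S. has_scalar_curvature A g S \<and> has_hessian A g u (\<lambda>p X Y. (S p - \<rho>) * g p X Y))"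

definition warped_metric ::
  "('b::topological_space, 'e::euclidean_space) chart set \<Rightarrow>
   ('f::topological_space, 'd::euclidean_space) chart set \<Rightarrow>
   'b tensor2 \<Rightarrow> ('b \<Rightarrow> real) \<Rightarrow> 'f tensor2 \<Rightarrow> ('b \<times> 'f) tensor2" where
  "warped_metric A\<^sub>B A\<^sub>F g\<^sub>B f g\<^sub>F =
     (\<lambda>p X Y. pullback A\<^sub>B fst g\<^sub>B p X Y + ((f \<circ> fst) p)\<^sup>2 * pullback A\<^sub>F snd g\<^sub>F p X Y)"

end

theory Submission
  imports Defs
begin

text \<open>
  Let \<open>d\<close> be the dimension of the fibre.  The scalar curvature of the warped product is
  \<open>S\<^sub>B + lam\<^sub>F / f\<^sup>2 - 2 d \<Delta>f / f - d (d - 1) |\<nabla>f|\<^sup>2 / f\<^sup>2\<close> (lemma \<open>scalar_curv_W\<close>), and the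
  soliton equation, evaluated on vertical vectors, says that this scalar curvature minus \<open>\<rho>\<close> is
  \<open>\<langle>\<nabla>f, \<nabla>h\<rangle> / f\<close> (lemma \<open>hess_W_vertical\<close>).  Together (lemma \<open>warped_soliton_identity\<close>)

    \<open>2 d \<Delta>f / f + d (d - 1) |\<nabla>f|\<^sup>2 / f\<^sup>2 + \<langle>\<nabla>f, \<nabla>h\<rangle> / f = S\<^sub>B + lam\<^sub>F / f\<^sup>2 - \<rho>\<close>,

  and the right-hand side is nonnegative by hypothesis.  Since \<open>f > 0\<close>, and since both gradient
  terms are linear in \<open>df\<close> once the other gradient is regarded as a coefficient, \<open>f\<close> is a
  subsolution of a linear elliptic operator without zeroth-order term.  The base metric being
  Riemannian, Hopf's strong maximum principle (\<open>strong_maximum_principle\<close>) applies in every chart, and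
  shows that the set where \<open>f\<close> takes its maximum is open.  It is also closed and nonempty, hence
  all of the connected base.

  The computation is carried out in the charts of the given atlases, where normal coordinates need
  not be available.  In a product chart the warped metric has the expected block form
  (\<open>coord_form_warped_metric\<close>), which requires that pushing forward coordinate vectors along the
  projections gives coordinate vectors.  Vectors obtained by raising an index are determined by
  their pairings (\<open>sharp_eqI\<close>), so Christoffel symbols and gradients are identified without
  inverting matrices, and they are differentiable by \<open>sharp_differentiable\<close>.
\<close>

section \<open>Directional derivatives\<close>

abbreviation fd :: "('a::real_normed_vector \<Rightarrow> 'b::real_normed_vector) \<Rightarrow> 'a \<Rightarrow> 'a \<Rightarrow> 'b" where
  "fd f x \<equiv> frechet_derivative f (at x)"

lemma fd_eqI: "(f has_derivative f') (at x) \<Longrightarrow> fd f x = f'"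
  using frechet_derivative_at by metis

lemma has_derivative_fd: "f differentiable (at x) \<Longrightarrow> (f has_derivative fd f x) (at x)"
  by (simp add: frechet_derivative_works)

lemma has_derivative_cong_open:
  assumes "open U" "x \<in> U" "\<And>y. y \<in> U \<Longrightarrow> f y = g y" "(g has_derivative g') (at x)"
  shows "(f has_derivative g') (at x)"
  using has_derivative_transform_within_open[OF assms(4,1,2)] assms(3) by auto

lemma differentiable_cong_open:
  assumes "open U" "x \<in> U" "\<And>y. y \<in> U \<Longrightarrow> f y = g y" "g differentiable (at x)"
  shows "f differentiable (at x)"
  using has_derivative_cong_open[OF assms(1,2), of f g] assms(3,4) unfolding differentiable_def by blast

lemma fd_cong_open:
  assumes "open U" "x \<in> U" "\<And>y. y \<in> U \<Longrightarrow> f y = g y"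
  shows "fd f x = fd g x"
proof -
  have "(f has_derivative f') (at x) \<longleftrightarrow> (g has_derivative f') (at x)" for f'
    using has_derivative_cong_open[OF assms(1,2), of f g f'] has_derivative_cong_open[OF assms(1,2), of g f f'] assms(3)
    by auto
  then show ?thesis unfolding frechet_derivative_def by simp
qed

definition twice_differentiable_on :: "'a::real_normed_vector set \<Rightarrow> ('a \<Rightarrow> 'b::real_normed_vector) \<Rightarrow> bool" where
  "twice_differentiable_on U f \<longleftrightarrow>
     (\<forall>x\<in>U. f differentiable (at x) \<and> (\<forall>v. (\<lambda>y. fd f y v) differentiable (at x)))"

lemma Ck_on_2_twice_differentiable: "Ck_on 2 U f \<Longrightarrow> twice_differentiable_on U f"
  by (simp add: numeral_2_eq_2 twice_differentiable_on_def)

lemma smooth_on_twice_differentiable: "smooth_on U f \<Longrightarrow> twice_differentiable_on U f"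
  using Ck_on_2_twice_differentiable smooth_on_def by blast

text \<open>
  In a general normed space \<open>at x\<close> may be trivial, and then \<open>netlimit (at x)\<close> in the definition of
  \<open>has_derivative\<close> need not be \<open>x\<close>; in that case both sides only say that \<open>f'\<close> is bounded linear.
\<close>

lemma has_derivative_at_lim:
  "(f has_derivative f') (at x) \<longleftrightarrow>
    bounded_linear f' \<and> ((\<lambda>y. ((f y - f x) - f' (y - x)) /\<^sub>R norm (y - x)) \<longlongrightarrow> 0) (at x)"
  unfolding has_derivative_def by (cases "at x = bot") (simp_all add: Lim_ident_at)

text \<open>
  Where one factor vanishes, continuity of the other factor suffices for the product rule: the
  derivative of \<open>k\<close> would be multiplied by \<open>f x = 0\<close>.  This is what turns continuity of the solution
  of a linear system into its differentiability.
\<close>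

lemma differentiable_mult_vanishing:
  fixes f k :: "'a::real_normed_vector \<Rightarrow> real"
  assumes f: "f differentiable (at x)" and f0: "f x = 0" and k: "isCont k x"
  shows "(\<lambda>y. k y * f y) differentiable (at x)"
proof -
  let ?f' = "fd f x"
  have D: "(f has_derivative ?f') (at x)" by (rule has_derivative_fd[OF f])
  have bl: "bounded_linear ?f'" using D by (rule has_derivative_bounded_linear)
  from bl obtain C where C: "\<And>h. norm (?f' h) \<le> norm h * C"
    using bounded_linear.bounded by blast
  have r: "((\<lambda>y. ((f y - f x) - ?f' (y - x)) /\<^sub>R norm (y - x)) \<longlongrightarrow> 0) (at x)"
    using D by (simp add: has_derivative_at_lim)
  have k0: "((\<lambda>y. k y - k x) \<longlongrightarrow> 0) (at x)"
    using k by (simp add: isCont_def LIM_zero)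
  have b: "\<forall>y. norm (?f' (y - x) /\<^sub>R norm (y - x)) \<le> \<bar>C\<bar>"
  proof
    fix y
    show "norm (?f' (y - x) /\<^sub>R norm (y - x)) \<le> \<bar>C\<bar>"
    proof (cases "y = x")
      case False
      have "norm (?f' (y - x)) \<le> \<bar>C\<bar> * norm (y - x)"
        using C[of "y - x"] by (smt (verit) mult.commute mult_right_mono norm_ge_zero)
      then show ?thesis using False by (simp add: field_simps)
    qed simp
  qed
  have s: "((\<lambda>y. (k y - k x) * (?f' (y - x) /\<^sub>R norm (y - x))) \<longlongrightarrow> 0) (at x)"
    by (rule Lim_null_comparison[where g = "\<lambda>y. \<bar>k y - k x\<bar> * \<bar>C\<bar>"])
      (use b tendsto_mult_left_zero[OF tendsto_rabs_zero[OF k0], of "\<bar>C\<bar>"]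
        in \<open>auto simp: abs_mult intro!: always_eventually mult_left_mono\<close>)
  have "((\<lambda>y. k y * (((f y - f x) - ?f' (y - x)) /\<^sub>R norm (y - x))
      + (k y - k x) * (?f' (y - x) /\<^sub>R norm (y - x))) \<longlongrightarrow> k x * 0 + 0) (at x)"
    using k r s unfolding isCont_def by (intro tendsto_add tendsto_mult) auto
  moreover have "k y * (((f y - f x) - ?f' (y - x)) /\<^sub>R norm (y - x))
      + (k y - k x) * (?f' (y - x) /\<^sub>R norm (y - x)) =
      ((k y * f y - k x * f x) - k x * ?f' (y - x)) /\<^sub>R norm (y - x)" for y
    by (simp add: f0 algebra_simps)
  ultimately have "((\<lambda>y. ((k y * f y - k x * f x) - k x * ?f' (y - x)) /\<^sub>R norm (y - x)) \<longlongrightarrow> 0) (at x)"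
    by simp
  then have "((\<lambda>y. k y * f y) has_derivative (\<lambda>h. k x * ?f' h)) (at x)"
    using bounded_linear_const_mult[OF bl, of "k x"] by (simp add: has_derivative_at_lim)
  then show ?thesis unfolding differentiable_def by blast
qed

section \<open>Raising an index\<close>

text \<open>
  The operator that represents \<open>G\<close> with respect to the Euclidean inner product (the Gram matrix);
  raising an index with \<open>G\<close> amounts to inverting it.
\<close>

definition form_op :: "('e::euclidean_space \<Rightarrow> 'e \<Rightarrow> real) \<Rightarrow> 'e \<Rightarrow> 'e" where
  "form_op G v = (\<Sum>i\<in>Basis. G v i *\<^sub>R i)"

lemma linear_form_op: "bilinear G \<Longrightarrow> linear (form_op G)"
  unfolding form_op_def
  by (intro linearI) (simp_all add: bilinear_ladd bilinear_lmul scaleR_add_left sum.distrib scaleR_sum_right)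

lemma linear_expansion:
  fixes f :: "'e::euclidean_space \<Rightarrow> 'a::real_vector"
  assumes "linear f"
  shows "f w = (\<Sum>i\<in>Basis. (w \<bullet> i) *\<^sub>R f i)"
proof -
  have "f w = f (\<Sum>i\<in>Basis. (w \<bullet> i) *\<^sub>R i)" by (simp add: euclidean_representation)
  then show ?thesis by (simp add: linear_sum[OF assms] linear_cmul[OF assms])
qed

lemma linear_eq_inner_Basis:
  fixes \<alpha> :: "'e::euclidean_space \<Rightarrow> real"
  assumes "linear \<alpha>"
  shows "(\<Sum>i\<in>Basis. \<alpha> i *\<^sub>R i) \<bullet> w = \<alpha> w"
  by (simp add: linear_expansion[OF assms, of w] inner_sum_left)
     (intro sum.cong refl, simp add: inner_commute)

lemma form_op_inner: "bilinear G \<Longrightarrow> form_op G v \<bullet> w = G v w"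
  unfolding form_op_def by (rule linear_eq_inner_Basis) (simp add: bilinear_def)

lemma inj_form_op:
  assumes "bilinear G" "nondegenerate G"
  shows "inj (form_op G)"
proof -
  have "v = 0" if "form_op G v = 0" for v
    using assms form_op_inner[OF assms(1), of v] that by (simp add: nondegenerate_def)
  then show ?thesis using linear_injective_0[OF linear_form_op[OF assms(1)]] by blast
qed

lemma sharp_eqI:
  assumes "bilinear G" "nondegenerate G" "\<And>w. G z w = \<alpha> w"
  shows "sharp G \<alpha> = z"
  unfolding sharp_def
proof (rule the_equality)
  show "\<forall>w. G z w = \<alpha> w" using assms by blast
  fix y assume y: "\<forall>w. G y w = \<alpha> w"
  have "G (y - z) w = 0" for w using y assms by (simp add: bilinear_lsub)
  then show "y = z" using assms(2) unfolding nondegenerate_def by (metis eq_iff_diff_eq_0)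
qed

lemma sharp_works:
  assumes "bilinear G" "nondegenerate G" "linear \<alpha>"
  shows "G (sharp G \<alpha>) w = \<alpha> w"
proof -
  have "surj (form_op G)"
    using linear_injective_imp_surjective[OF linear_form_op inj_form_op] assms by blast
  then obtain z where "form_op G z = (\<Sum>i\<in>Basis. \<alpha> i *\<^sub>R i)" by (metis surjD)
  then have z: "G z w = \<alpha> w" for w
    using form_op_inner[OF assms(1), of z w] linear_eq_inner_Basis[OF assms(3)] by simp
  then show ?thesis using sharp_eqI[OF assms(1,2) z] by simp
qed

text \<open>
  The solution \<open>z y\<close> of the nondegenerate linear system \<open>G y (z y) \<cdot> = \<alpha> y\<close> depends
  differentiably on \<open>y\<close>.  With \<open>M\<close> the inverse of the system at the fixed point \<open>x\<close>, it satisfies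
  \<open>z y = M (a y) - M ((G y - G x) (z y))\<close>.  Since \<open>G y - G x\<close> is small near \<open>x\<close>, this bounds \<open>z\<close>,
  then shows that \<open>z\<close> is continuous at \<open>x\<close>, and then, since the coefficients of \<open>G y - G x\<close> vanish
  at \<open>x\<close>, that it is differentiable there.  No formula for the inverse matrix is involved, so the
  argument is the same for every signature.
\<close>

lemma sharp_differentiable:
  fixes G :: "'a::real_normed_vector \<Rightarrow> 'e::euclidean_space \<Rightarrow> 'e \<Rightarrow> real"
  assumes U: "open U" "x \<in> U"
    and G: "\<And>y. y \<in> U \<Longrightarrow> bilinear (G y)" "\<And>y. y \<in> U \<Longrightarrow> nondegenerate (G y)"
    and dG: "\<And>v w. (\<lambda>y. G y v w) differentiable (at x)"
    and \<alpha>: "\<And>y. y \<in> U \<Longrightarrow> linear (\<alpha> y)" and d\<alpha>: "\<And>w. (\<lambda>y. \<alpha> y w) differentiable (at x)"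
  shows "(\<lambda>y. sharp (G y) (\<alpha> y)) differentiable (at x)"
proof -
  define z where "z = (\<lambda>y. sharp (G y) (\<alpha> y))"
  define a where "a = (\<lambda>y. \<Sum>i\<in>Basis. \<alpha> y i *\<^sub>R i)"
  obtain M where M: "linear M" and MG: "\<And>v. M (form_op (G x) v) = v"
    using linear_injective_left_inverse[OF linear_form_op inj_form_op, of "G x"] G U
    by (metis comp_apply id_apply)
  define q where "q = (\<lambda>y. M (a y))"
  define E where "E = (\<lambda>y. \<Sum>j\<in>Basis. \<Sum>i\<in>Basis. \<bar>G y j i - G x j i\<bar> * norm (M i))"
  have op_z: "form_op (G y) (z y) = a y" if "y \<in> U" for y
    unfolding form_op_def a_def z_def using sharp_works[OF G[OF that] \<alpha>[OF that]] by simp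
  \<comment> \<open>The linear system at \<open>y\<close>, rewritten as a perturbation of the system at \<open>x\<close>.\<close>
  have zq: "z y = q y - (\<Sum>j\<in>Basis. \<Sum>i\<in>Basis. ((z y \<bullet> j) * (G y j i - G x j i)) *\<^sub>R M i)"
    if y: "y \<in> U" for y
  proof -
    have ex: "G t v i = (\<Sum>j\<in>Basis. (v \<bullet> j) * G t j i)" if "t \<in> U" for t v i
    proof -
      have "linear (\<lambda>v. G t v i)" using G(1)[OF that] by (simp add: bilinear_def)
      from linear_expansion[OF this, of v] show ?thesis by simp
    qed
    have "form_op (G x) (z y) = a y - (form_op (G y) (z y) - form_op (G x) (z y))"
      using op_z[OF y] by simp
    also have "form_op (G y) (z y) - form_op (G x) (z y) =
        (\<Sum>i\<in>Basis. \<Sum>j\<in>Basis. ((z y \<bullet> j) * (G y j i - G x j i)) *\<^sub>R i)"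
      unfolding form_op_def
      by (simp add: ex[OF y, of "z y"] ex[OF U(2), of "z y"] sum_subtractf[symmetric]
          scaleR_diff_left[symmetric] scaleR_sum_left right_diff_distrib)
    also have "\<dots> = (\<Sum>j\<in>Basis. \<Sum>i\<in>Basis. ((z y \<bullet> j) * (G y j i - G x j i)) *\<^sub>R i)"
      by (rule sum.swap)
    finally have "M (form_op (G x) (z y)) =
        M (a y - (\<Sum>j\<in>Basis. \<Sum>i\<in>Basis. ((z y \<bullet> j) * (G y j i - G x j i)) *\<^sub>R i))" by simp
    then show ?thesis
      using M by (simp add: MG q_def linear_diff linear_sum linear_cmul)
  qed
  have norm_zq: "norm (z y - q y) \<le> E y * norm (z y)" if "y \<in> U" for y
  proof -
    have "norm (z y - q y) = norm (\<Sum>j\<in>Basis. \<Sum>i\<in>Basis. ((z y \<bullet> j) * (G y j i - G x j i)) *\<^sub>R M i)"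
      by (subst zq[OF that]) (simp add: norm_minus_commute)
    also have "\<dots> \<le> (\<Sum>j\<in>Basis. \<Sum>i\<in>Basis. norm (z y) * (\<bar>G y j i - G x j i\<bar> * norm (M i)))"
      by (intro sum_norm_le order_trans[OF norm_sum] sum_mono)
         (auto simp: abs_mult mult.assoc intro!: mult_right_mono Basis_le_norm)
    also have "\<dots> = E y * norm (z y)"
      unfolding E_def by (simp add: sum_distrib_left[symmetric] mult.commute)
    finally show ?thesis .
  qed
  have cG: "isCont (\<lambda>y. G y v w) x" for v w
    using dG differentiable_imp_continuous_within by blast
  have "isCont E x" unfolding E_def by (intro continuous_intros cG)
  moreover have "E x = 0" by (simp add: E_def)
  ultimately have E0: "(E \<longlongrightarrow> 0) (at x)" by (simp add: isCont_def)
  have da: "a differentiable (at x)"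
    unfolding a_def by (intro differentiable_sum ballI differentiable_scaleR d\<alpha> differentiable_const) auto
  have blM: "bounded_linear M" using M by (simp add: linear_conv_bounded_linear)
  have dq: "q differentiable (at x)"
    unfolding q_def using differentiable_compose[OF _ da, of M]
      bounded_linear_imp_differentiable[OF blM] by blast
  have cq: "isCont q x" using dq differentiable_imp_continuous_within by blast
  have qx: "q x = z x" using op_z[OF U(2)] MG[of "z x"] by (simp add: q_def)
  have inU: "\<forall>\<^sub>F y in at x. y \<in> U" using U eventually_at_topological by blast
  \<comment> \<open>Once \<open>E y < 1/2\<close>, the perturbation term is absorbed into the left-hand side.\<close>
  have ev: "\<forall>\<^sub>F y in at x. norm (z y - q y) \<le> E y * (2 * norm (q y))"
    using inU order_tendstoD(2)[OF E0, of "1/2", simplified]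
  proof eventually_elim
    case (elim y)
    have E_nonneg: "E y \<ge> 0" unfolding E_def by (intro sum_nonneg) auto
    have "norm (z y) \<le> norm (q y) + E y * norm (z y)"
      using norm_zq[OF elim(1)] norm_triangle_sub[of "z y" "q y"] by linarith
    also have "E y * norm (z y) \<le> 1/2 * norm (z y)"
      using elim(2) by (intro mult_right_mono) auto
    finally have "norm (z y) \<le> 2 * norm (q y)" by simp
    then show ?case using norm_zq[OF elim(1)] mult_left_mono[OF _ E_nonneg] by (meson order_trans)
  qed
  have "((\<lambda>y. E y * (2 * norm (q y))) \<longlongrightarrow> 0 * (2 * norm (q x))) (at x)"
    using cq by (intro tendsto_mult E0 tendsto_const tendsto_norm) (simp add: isCont_def)
  then have "((\<lambda>y. z y - q y) \<longlongrightarrow> 0) (at x)"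
    using Lim_null_comparison[OF ev] by simp
  then have "((\<lambda>y. (z y - q y) + q y) \<longlongrightarrow> 0 + q x) (at x)"
    using cq by (intro tendsto_add) (auto simp: isCont_def)
  then have cz: "isCont z x" by (simp add: isCont_def qx)
  have "(\<lambda>y. q y - (\<Sum>j\<in>Basis. \<Sum>i\<in>Basis. ((z y \<bullet> j) * (G y j i - G x j i)) *\<^sub>R M i))
      differentiable (at x)"
    by (intro differentiable_diff dq differentiable_sum differentiable_scaleR
        differentiable_mult_vanishing dG ballI differentiable_const continuous_intros cz) auto
  then have "z differentiable (at x)"
    by (rule differentiable_cong_open[OF U, rotated]) (use zq in simp)
  then show ?thesis by (simp add: z_def)
qed

lemma linear_inner_right_arg: "linear (\<lambda>w. w \<bullet> i)"
  by (simp add: bounded_linear.linear bounded_linear_inner_left)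

lemma sharp_expansion:
  assumes "bilinear G" "nondegenerate G" "linear \<alpha>"
  shows "sharp G \<alpha> = (\<Sum>i\<in>Basis. \<alpha> i *\<^sub>R sharp G (\<lambda>w. w \<bullet> i))"
proof (rule sharp_eqI[OF assms(1,2)])
  fix w
  have l: "linear (\<lambda>v. G v w)" using assms(1) by (simp add: bilinear_def)
  have "G (\<Sum>i\<in>Basis. \<alpha> i *\<^sub>R sharp G (\<lambda>w. w \<bullet> i)) w = (\<Sum>i\<in>Basis. \<alpha> i * (w \<bullet> i))"
    by (simp add: linear_sum[OF l] linear_cmul[OF l] sharp_works[OF assms(1,2) linear_inner_right_arg])
  also have "\<dots> = \<alpha> w"
    by (simp add: linear_expansion[OF assms(3), of w] mult.commute)
  finally show "G (\<Sum>i\<in>Basis. \<alpha> i *\<^sub>R sharp G (\<lambda>w. w \<bullet> i)) w = \<alpha> w" .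
qed

lemma inverse_metric_eq:
  assumes "bilinear G" "nondegenerate G"
  shows "inverse_metric G i j = G (sharp G (\<lambda>w. w \<bullet> j)) (sharp G (\<lambda>w. w \<bullet> i))"
  by (simp add: sharp_works[OF assms linear_inner_right_arg] inverse_metric_def)

lemma inverse_metric_sym:
  assumes "bilinear G" "nondegenerate G" "\<And>v w. G v w = G w v"
  shows "inverse_metric G i j = inverse_metric G j i"
  using inverse_metric_eq[OF assms(1,2)] assms(3) by simp

section \<open>A semi-Riemannian metric in a chart\<close>

text \<open>
  The coordinate expression of a metric of arbitrary signature.  Two derivatives are what the
  curvature needs: the Christoffel symbols contain the first derivatives of \<open>G\<close> and have to be
  differentiable once more.
\<close>

locale chart_metric =
  fixes U :: "'e::euclidean_space set" and G :: "'e \<Rightarrow> 'e \<Rightarrow> 'e \<Rightarrow> real"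
  assumes open_U: "open U"
    and bilinear_G: "x \<in> U \<Longrightarrow> bilinear (G x)"
    and sym_G: "x \<in> U \<Longrightarrow> G x v w = G x w v"
    and nondegenerate_G: "x \<in> U \<Longrightarrow> nondegenerate (G x)"
    and twice_differentiable_G: "twice_differentiable_on U (\<lambda>x. G x v w)"
begin

lemma differentiable_G: "x \<in> U \<Longrightarrow> (\<lambda>y. G y v w) differentiable (at x)"
  and differentiable_fd_G: "x \<in> U \<Longrightarrow> (\<lambda>y. fd (\<lambda>y. G y v w) y u) differentiable (at x)"
  using twice_differentiable_G by (auto simp: twice_differentiable_on_def)

lemma linear_fd_G: "x \<in> U \<Longrightarrow> linear (fd (\<lambda>y. G y v w) x)"
  by (rule linear_frechet_derivative[OF differentiable_G])

lemma fd_G_sym: "x \<in> U \<Longrightarrow> fd (\<lambda>y. G y v w) x = fd (\<lambda>y. G y w v) x"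
  by (rule fd_cong_open[OF open_U]) (auto intro: sym_G)

lemma linear_fd_G_arg:
  assumes "x \<in> U"
  shows "linear (\<lambda>z. fd (\<lambda>y. G y v z) x u)"
proof (rule linearI)
  fix z1 z2
  have "fd (\<lambda>y. G y v (z1 + z2)) x = fd (\<lambda>y. G y v z1 + G y v z2) x"
    by (rule fd_cong_open[OF open_U assms]) (simp add: bilinear_G bilinear_radd)
  also have "\<dots> = (\<lambda>h. fd (\<lambda>y. G y v z1) x h + fd (\<lambda>y. G y v z2) x h)"
    by (intro fd_eqI has_derivative_add has_derivative_fd differentiable_G assms)
  finally show "fd (\<lambda>y. G y v (z1 + z2)) x u = fd (\<lambda>y. G y v z1) x u + fd (\<lambda>y. G y v z2) x u" by simp
next
  fix r z
  have "fd (\<lambda>y. G y v (r *\<^sub>R z)) x = fd (\<lambda>y. r * G y v z) x"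
    by (rule fd_cong_open[OF open_U assms]) (simp add: bilinear_G bilinear_rmul)
  also have "\<dots> = (\<lambda>h. r * fd (\<lambda>y. G y v z) x h)"
    by (intro fd_eqI has_derivative_mult_right has_derivative_fd differentiable_G assms)
  finally show "fd (\<lambda>y. G y v (r *\<^sub>R z)) x u = r *\<^sub>R fd (\<lambda>y. G y v z) x u" by simp
qed

lemma linear_koszul:
  assumes "x \<in> U"
  shows "linear (\<lambda>z. (fd (\<lambda>y. G y w z) x v + fd (\<lambda>y. G y v z) x w - fd (\<lambda>y. G y v w) x z) / 2)"
proof -
  have "linear (\<lambda>z. (1/2::real) *\<^sub>R (fd (\<lambda>y. G y w z) x v + fd (\<lambda>y. G y v z) x w - fd (\<lambda>y. G y v w) x z))"
    by (intro linear_compose_scale_right linear_compose_sub linear_compose_add linear_fd_G_arg linear_fd_G assms)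
  then show ?thesis by simp
qed

lemma G_sharp: "x \<in> U \<Longrightarrow> linear \<alpha> \<Longrightarrow> G x (sharp (G x) \<alpha>) w = \<alpha> w"
  using sharp_works bilinear_G nondegenerate_G by blast

lemma G_christoffel:
  "x \<in> U \<Longrightarrow> G x (christoffel G x v w) z =
    (fd (\<lambda>y. G y w z) x v + fd (\<lambda>y. G y v z) x w - fd (\<lambda>y. G y v w) x z) / 2"
  unfolding christoffel_def by (rule G_sharp[OF _ linear_koszul])

lemma christoffel_differentiable:
  "x \<in> U \<Longrightarrow> (\<lambda>y. christoffel G y v w) differentiable (at x)"
  unfolding christoffel_def
  by (rule sharp_differentiable[OF open_U _ bilinear_G nondegenerate_G differentiable_G linear_koszul])
     (auto intro!: derivative_intros differentiable_fd_G)

lemma christoffel_eqI: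
  assumes "x \<in> U"
    and "\<And>z. G x a z = (fd (\<lambda>y. G y w z) x v + fd (\<lambda>y. G y v z) x w - fd (\<lambda>y. G y v w) x z) / 2"
  shows "christoffel G x v w = a"
  unfolding christoffel_def
  using assms by (intro sharp_eqI bilinear_G nondegenerate_G)

lemma gradient_differentiable:
  assumes "twice_differentiable_on U F" "x \<in> U"
  shows "(\<lambda>y. sharp (G y) (fd F y)) differentiable (at x)"
  by (rule sharp_differentiable[OF open_U assms(2) bilinear_G nondegenerate_G differentiable_G])
     (use assms in \<open>auto simp: twice_differentiable_on_def intro: linear_frechet_derivative\<close>)

lemma christoffel_sym: "x \<in> U \<Longrightarrow> christoffel G x v w = christoffel G x w v"
  by (rule christoffel_eqI) (simp_all add: G_christoffel fd_G_sym[of x v w])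

lemma christoffel_scale_right:
  "x \<in> U \<Longrightarrow> christoffel G x v (r *\<^sub>R w) = r *\<^sub>R christoffel G x v w"
proof (rule christoffel_eqI)
  fix z assume x: "x \<in> U"
  have l: "fd (\<lambda>y. G y a (r *\<^sub>R b)) x c = r * fd (\<lambda>y. G y a b) x c" for a b c
    using linear_cmul[OF linear_fd_G_arg[OF x]] by simp
  show "G x (r *\<^sub>R christoffel G x v w) z =
    (fd (\<lambda>y. G y (r *\<^sub>R w) z) x v + fd (\<lambda>y. G y v z) x (r *\<^sub>R w) - fd (\<lambda>y. G y v (r *\<^sub>R w)) x z) / 2"
    using x
    by (simp add: fd_G_sym[of x "r *\<^sub>R w" z] fd_G_sym[of x w z] l bilinear_lmul[OF bilinear_G]
        G_christoffel linear_cmul[OF linear_fd_G] algebra_simps)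
qed

lemma christoffel_zero [simp]:
  "x \<in> U \<Longrightarrow> christoffel G x v 0 = 0" "x \<in> U \<Longrightarrow> christoffel G x 0 v = 0"
  using christoffel_scale_right[of x v 0 0] christoffel_sym[of x v 0] by simp_all

definition gradient :: "('e \<Rightarrow> real) \<Rightarrow> 'e \<Rightarrow> 'e" where
  "gradient F x = sharp (G x) (fd F x)"

definition laplacian :: "('e \<Rightarrow> real) \<Rightarrow> 'e \<Rightarrow> real" where
  "laplacian F x = (\<Sum>i\<in>Basis. \<Sum>j\<in>Basis. inverse_metric (G x) i j * hess G F x i j)"

lemma G_gradient: "x \<in> U \<Longrightarrow> F differentiable (at x) \<Longrightarrow> G x (gradient F x) w = fd F x w"
  unfolding gradient_def by (rule G_sharp) (auto intro: linear_frechet_derivative)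

text \<open>
  The Hessian is the covariant derivative of the gradient.  Differentiating
  \<open>G (gradient F) w = dF w\<close> in the direction \<open>u\<close> gives the derivative of \<open>G\<close> in addition to that of
  the gradient, and the two Koszul formulas for \<open>\<nabla>\<^sub>u (gradient F)\<close> and \<open>\<nabla>\<^sub>u w\<close> add up to exactly this
  term (compatibility of the connection with the metric).
\<close>

lemma G_covariant_derivative_gradient:
  assumes F: "twice_differentiable_on U F" and x: "x \<in> U"
  shows "G x (fd (gradient F) x u + christoffel G x u (gradient F x)) w = hess G F x u w"
proof -
  let ?N = "gradient F"
  have dF: "F differentiable (at y)" if "y \<in> U" for y
    using F that by (simp add: twice_differentiable_on_def)
  have dN: "?N differentiable (at x)"
    using gradient_differentiable[OF F x] by (simp add: gradient_def[abs_def])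
  \<comment> \<open>Both arguments of \<open>G y (gradient F y) w\<close> depend on \<open>y\<close>; expanding in a basis separates them.\<close>
  have "fd (\<lambda>y. fd F y w) x = fd (\<lambda>y. \<Sum>j\<in>Basis. (?N y \<bullet> j) * G y j w) x"
  proof (rule fd_cong_open[OF open_U x])
    fix y assume y: "y \<in> U"
    have l: "linear (\<lambda>v. G y v w)" using bilinear_G[OF y] by (simp add: bilinear_def)
    show "fd F y w = (\<Sum>j\<in>Basis. (?N y \<bullet> j) * G y j w)"
      using G_gradient[OF y dF[OF y]] linear_expansion[OF l, of "?N y"] by simp
  qed
  also have "\<dots> = (\<lambda>h. \<Sum>j\<in>Basis. (?N x \<bullet> j) * fd (\<lambda>y. G y j w) x h + (fd ?N x h \<bullet> j) * G x j w)"
    by (intro fd_eqI has_derivative_sum has_derivative_mult has_derivative_inner_left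
        has_derivative_fd dN differentiable_G x)
  finally have "fd (\<lambda>y. fd F y w) x u =
      (\<Sum>j\<in>Basis. (?N x \<bullet> j) * fd (\<lambda>y. G y j w) x u) + (\<Sum>j\<in>Basis. (fd ?N x u \<bullet> j) * G x j w)"
    by (simp add: sum.distrib)
  also have "(\<Sum>j\<in>Basis. (?N x \<bullet> j) * fd (\<lambda>y. G y j w) x u) = fd (\<lambda>y. G y (?N x) w) x u"
    using linear_expansion[OF linear_fd_G_arg[OF x, of w u], of "?N x"] by (simp add: fd_G_sym[OF x, of w])
  also have "(\<Sum>j\<in>Basis. (fd ?N x u \<bullet> j) * G x j w) = G x (fd ?N x u) w"
  proof -
    have l: "linear (\<lambda>v. G x v w)" using bilinear_G[OF x] by (simp add: bilinear_def)
    show ?thesis using linear_expansion[OF l, of "fd ?N x u"] by simp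
  qed
  finally have D: "fd (\<lambda>y. fd F y w) x u = fd (\<lambda>y. G y (?N x) w) x u + G x (fd ?N x u) w" .
  have "fd F x (christoffel G x u w) = G x (christoffel G x u w) (?N x)"
    using G_gradient[OF x dF[OF x]] sym_G[OF x] by metis
  then show ?thesis
    unfolding hess_def D
    by (simp add: bilinear_ladd[OF bilinear_G[OF x]] G_christoffel[OF x] fd_G_sym[OF x, of w] field_simps)
qed

lemma divergence_gradient:
  assumes F: "twice_differentiable_on U F" and x: "x \<in> U"
  shows "(\<Sum>i\<in>Basis. (fd (gradient F) x i + christoffel G x i (gradient F x)) \<bullet> i) = laplacian F x"
proof -
  have "(fd (gradient F) x i + christoffel G x i (gradient F x)) \<bullet> i =
      (\<Sum>j\<in>Basis. inverse_metric (G x) i j * hess G F x i j)" for i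
  proof -
    let ?Z = "fd (gradient F) x i + christoffel G x i (gradient F x)"
    have l: "linear (G x ?Z)" using bilinear_G[OF x] by (simp add: bilinear_def)
    have "?Z = sharp (G x) (G x ?Z)"
      by (rule sharp_eqI[symmetric]) (auto intro: x bilinear_G nondegenerate_G)
    then have "?Z \<bullet> i = (\<Sum>j\<in>Basis. G x ?Z j *\<^sub>R sharp (G x) (\<lambda>w. w \<bullet> j)) \<bullet> i"
      using sharp_expansion[OF bilinear_G[OF x] nondegenerate_G[OF x] l] by metis
    also have "\<dots> = (\<Sum>j\<in>Basis. hess G F x i j * inverse_metric (G x) j i)"
      unfolding G_covariant_derivative_gradient[OF F x] by (simp add: inner_sum_left inverse_metric_def)
    finally show ?thesis
      by (simp add: inverse_metric_sym[OF bilinear_G[OF x] nondegenerate_G[OF x] sym_G[OF x], of i] mult.commute)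
  qed
  then show ?thesis unfolding laplacian_def by simp
qed

lemma trace_metric:
  assumes x: "x \<in> U"
  shows "(\<Sum>i\<in>Basis. \<Sum>j\<in>Basis. inverse_metric (G x) i j * G x i j) = DIM('e)"
proof -
  have "(\<Sum>j\<in>Basis. inverse_metric (G x) i j * G x i j) = 1" if "i \<in> Basis" for i
  proof -
    let ?z = "sharp (G x) (\<lambda>w. w \<bullet> i)"
    have l: "linear (G x i)" using bilinear_G[OF x] by (simp add: bilinear_def)
    have "(\<Sum>j\<in>Basis. inverse_metric (G x) i j * G x i j) = G x i ?z"
      using linear_expansion[OF l, of ?z] by (simp add: inverse_metric_def)
    also have "\<dots> = 1"
      using G_sharp[OF x linear_inner_right_arg, of i i] sym_G[OF x, of i ?z] that by simp
    finally show ?thesis .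
  qed
  then show ?thesis by simp
qed

end

section \<open>Curvature of a warped product in a chart\<close>

lemma has_derivative_compose_fst:
  assumes "f differentiable (at (fst p))"
  shows "((\<lambda>q. f (fst q)) has_derivative (\<lambda>h. fd f (fst p) (fst h))) (at p)"
  using has_derivative_compose[where f = fst and g = f, OF has_derivative_fst[OF has_derivative_ident]
      has_derivative_fd[OF assms]] .

lemma has_derivative_compose_snd:
  assumes "f differentiable (at (snd p))"
  shows "((\<lambda>q. f (snd q)) has_derivative (\<lambda>h. fd f (snd p) (snd h))) (at p)"
  using has_derivative_compose[where f = snd and g = f, OF has_derivative_snd[OF has_derivative_ident]
      has_derivative_fd[OF assms]] .

definition warped_form ::
  "('e::euclidean_space \<Rightarrow> 'e \<Rightarrow> 'e \<Rightarrow> real) \<Rightarrow> ('e \<Rightarrow> real) \<Rightarrow> ('d::euclidean_space \<Rightarrow> 'd \<Rightarrow> 'd \<Rightarrow> real)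
     \<Rightarrow> 'e \<times> 'd \<Rightarrow> 'e \<times> 'd \<Rightarrow> 'e \<times> 'd \<Rightarrow> real" where
  "warped_form G f K p v w =
     G (fst p) (fst v) (fst w) + (f (fst p))\<^sup>2 * K (snd p) (snd v) (snd w)"

locale warped_chart = B: chart_metric U G + F: chart_metric V K
  for U :: "'e::euclidean_space set" and G and V :: "'d::euclidean_space set" and K +
  fixes f :: "'e \<Rightarrow> real"
  assumes twice_differentiable_f: "twice_differentiable_on U f"
    and f_pos: "x \<in> U \<Longrightarrow> f x > 0"
begin

abbreviation "W \<equiv> warped_form G f K"
abbreviation "N \<equiv> B.gradient f"

lemma open_UV: "open (U \<times> V)"
  by (intro open_Times B.open_U F.open_U)

lemma differentiable_f: "x \<in> U \<Longrightarrow> f differentiable (at x)"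
  and differentiable_fd_f: "x \<in> U \<Longrightarrow> (\<lambda>y. fd f y v) differentiable (at x)"
  using twice_differentiable_f by (auto simp: twice_differentiable_on_def)

lemma linear_fd_f: "x \<in> U \<Longrightarrow> linear (fd f x)"
  by (rule linear_frechet_derivative[OF differentiable_f])

lemma fd_f_zero: "x \<in> U \<Longrightarrow> fd f x 0 = 0"
  using linear_0[OF linear_fd_f] .

lemma differentiable_N: "x \<in> U \<Longrightarrow> N differentiable (at x)"
  using B.gradient_differentiable[OF twice_differentiable_f] by (simp add: B.gradient_def[abs_def])

lemma bilinear_W: "x \<in> U \<Longrightarrow> y \<in> V \<Longrightarrow> bilinear (W (x, y))"
  unfolding bilinear_def warped_form_def
  by (auto intro!: linearI
      simp: bilinear_ladd[OF B.bilinear_G] bilinear_radd[OF B.bilinear_G]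
        bilinear_lmul[OF B.bilinear_G] bilinear_rmul[OF B.bilinear_G]
        bilinear_ladd[OF F.bilinear_G] bilinear_radd[OF F.bilinear_G]
        bilinear_lmul[OF F.bilinear_G] bilinear_rmul[OF F.bilinear_G] algebra_simps)

lemma nondegenerate_W:
  assumes x: "x \<in> U" and y: "y \<in> V"
  shows "nondegenerate (W (x, y))"
  unfolding nondegenerate_def
proof (intro allI impI)
  fix v assume v: "\<forall>w. W (x, y) v w = 0"
  have "G x (fst v) w = 0" for w
    using v[rule_format, of "(w, 0)"] y by (simp add: warped_form_def bilinear_rzero[OF F.bilinear_G])
  moreover have "K y (snd v) w = 0" for w
    using v[rule_format, of "(0, w)"] x f_pos[OF x] by (simp add: warped_form_def bilinear_rzero[OF B.bilinear_G])
  ultimately show "v = 0"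
    using B.nondegenerate_G[OF x] F.nondegenerate_G[OF y]
    unfolding nondegenerate_def by (auto simp: prod_eq_iff)
qed

lemma fd_W:
  assumes x: "x \<in> U" and y: "y \<in> V"
  shows "fd (\<lambda>p. W p v w) (x, y) h = fd (\<lambda>t. G t (fst v) (fst w)) x (fst h)
    + 2 * f x * fd f x (fst h) * K y (snd v) (snd w)
    + (f x)\<^sup>2 * fd (\<lambda>t. K t (snd v) (snd w)) y (snd h)"
proof -
  note d1 = has_derivative_compose_fst[of "\<lambda>t. G t (fst v) (fst w)" "(x, y)"]
  note d2 = has_derivative_compose_fst[of f "(x, y)"]
  note d3 = has_derivative_compose_snd[of "\<lambda>t. K t (snd v) (snd w)" "(x, y)"]
  have "((\<lambda>p. W p v w) has_derivative (\<lambda>h. fd (\<lambda>t. G t (fst v) (fst w)) x (fst h)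
    + 2 * f x * fd f x (fst h) * K y (snd v) (snd w)
    + (f x)\<^sup>2 * fd (\<lambda>t. K t (snd v) (snd w)) y (snd h))) (at (x, y))"
    unfolding warped_form_def
    by (rule derivative_eq_intros d1 d2 d3 | use x y B.differentiable_G F.differentiable_G differentiable_f in force)+
  then show ?thesis by (simp add: fd_eqI)
qed

text \<open>
  The Levi-Civita connection of a warped product.  For horizontal fields it is the connection of
  the base; mixed covariant derivatives are \<open>(df v / f) w\<close>; vertical ones have the tangential part
  \<open>\<nabla>\<^sup>F\<close> and the normal part \<open>- f K(v, w) gradient f\<close>.  As \<open>sharp\<close> is characterised by its
  pairings, it is enough to pair the right-hand side with an arbitrary vector.
\<close>

lemma christoffel_W:
  assumes x: "x \<in> U" and y: "y \<in> V"
  shows "christoffel W (x, y) v w =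
    (christoffel G x (fst v) (fst w) - (f x * K y (snd v) (snd w)) *\<^sub>R N x,
     christoffel K y (snd v) (snd w) + (fd f x (fst v) / f x) *\<^sub>R snd w + (fd f x (fst w) / f x) *\<^sub>R snd v)"
  unfolding christoffel_def[of W] fd_W[OF x y]
  using f_pos[OF x]
  by (intro sharp_eqI bilinear_W nondegenerate_W x y)
     (simp add: warped_form_def bilinear_lsub[OF B.bilinear_G[OF x]]
       bilinear_lmul[OF B.bilinear_G[OF x]] bilinear_ladd[OF F.bilinear_G[OF y]]
       bilinear_lmul[OF F.bilinear_G[OF y]] B.G_christoffel[OF x] F.G_christoffel[OF y]
       B.G_gradient[OF x differentiable_f[OF x]] field_simps power2_eq_square)

lemma fd_christoffel_W_horizontal:
  assumes x: "x \<in> U" and y: "y \<in> V"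
  shows "fd (\<lambda>p. christoffel W p (v, 0) (w, 0)) (x, y) h = (fd (\<lambda>t. christoffel G t v w) x (fst h), 0)"
proof -
  have "fd (\<lambda>p. christoffel W p (v, 0) (w, 0)) (x, y) = fd (\<lambda>p. (christoffel G (fst p) v w, 0)) (x, y)"
    by (rule fd_cong_open[OF open_UV])
       (use x y in \<open>auto simp: christoffel_W bilinear_lzero[OF F.bilinear_G]\<close>)
  also have "\<dots> = (\<lambda>h. (fd (\<lambda>t. christoffel G t v w) x (fst h), 0))"
    using has_derivative_compose_fst[of "\<lambda>t. christoffel G t v w" "(x, y)"]
    by (intro fd_eqI has_derivative_Pair has_derivative_const) (simp add: B.christoffel_differentiable x)
  finally show ?thesis by simp
qed

lemma fd_christoffel_W_mixed:
  assumes x: "x \<in> U" and y: "y \<in> V"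
  shows "fd (\<lambda>p. christoffel W p (v, 0) (0, w)) (x, y) h =
    (0, (fd (\<lambda>t. fd f t v) x (fst h) / f x - fd f x v * fd f x (fst h) / (f x)\<^sup>2) *\<^sub>R w)"
    (is "_ = ?R h")
    and "fd (\<lambda>p. christoffel W p (0, w) (v, 0)) (x, y) = fd (\<lambda>p. christoffel W p (v, 0) (0, w)) (x, y)"
proof -
  note d1 = has_derivative_compose_fst[of "\<lambda>t. fd f t v" "(x, y)", simplified, OF differentiable_fd_f[OF x]]
  note d2 = has_derivative_compose_fst[of f "(x, y)", simplified, OF differentiable_f[OF x]]
  have d: "((\<lambda>p. fd f (fst p) v / f (fst p)) has_derivative
      (\<lambda>h. fd (\<lambda>t. fd f t v) x (fst h) / f x - fd f x v * fd f x (fst h) / (f x)\<^sup>2)) (at (x, y))"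
    using f_pos[OF x]
    by (auto intro!: derivative_eq_intros d1 d2 simp: field_simps power2_eq_square)
  have "((\<lambda>p. (0 :: 'e, (fd f (fst p) v / f (fst p)) *\<^sub>R w)) has_derivative ?R) (at (x, y))"
    by (intro has_derivative_Pair has_derivative_const has_derivative_scaleR_left d)
  then have D: "fd (\<lambda>p. (0 :: 'e, (fd f (fst p) v / f (fst p)) *\<^sub>R w)) (x, y) = ?R"
    by (rule fd_eqI)
  have "fd (\<lambda>p. christoffel W p (v, 0) (0, w)) (x, y) = fd (\<lambda>p. (0, (fd f (fst p) v / f (fst p)) *\<^sub>R w)) (x, y)"
    by (rule fd_cong_open[OF open_UV])
       (use x y in \<open>auto simp: christoffel_W bilinear_lzero[OF F.bilinear_G]\<close>)
  with D show "fd (\<lambda>p. christoffel W p (v, 0) (0, w)) (x, y) h = ?R h" by simp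
  show "fd (\<lambda>p. christoffel W p (0, w) (v, 0)) (x, y) = fd (\<lambda>p. christoffel W p (v, 0) (0, w)) (x, y)"
    by (rule fd_cong_open[OF open_UV])
       (use x y in \<open>auto simp: christoffel_W bilinear_lzero[OF F.bilinear_G] bilinear_rzero[OF F.bilinear_G]\<close>)
qed

lemma fd_christoffel_W_vertical:
  assumes x: "x \<in> U" and y: "y \<in> V"
  shows "fd (\<lambda>p. christoffel W p (0, v) (0, w)) (x, y) h =
    (- (fd f x (fst h) * K y v w + f x * fd (\<lambda>t. K t v w) y (snd h)) *\<^sub>R N x
       - (f x * K y v w) *\<^sub>R fd N x (fst h),
     fd (\<lambda>t. christoffel K t v w) y (snd h))" (is "_ = ?R h")
proof -
  note d1 = has_derivative_compose_fst[of f "(x, y)", simplified, OF differentiable_f[OF x]]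
  note d2 = has_derivative_compose_snd[of "\<lambda>t. K t v w" "(x, y)", simplified, OF F.differentiable_G[OF y]]
  note d3 = has_derivative_compose_fst[of N "(x, y)", simplified, OF differentiable_N[OF x]]
  note d4 = has_derivative_compose_snd[of "\<lambda>t. christoffel K t v w" "(x, y)", simplified, OF F.christoffel_differentiable[OF y]]
  have "fd (\<lambda>p. christoffel W p (0, v) (0, w)) (x, y) =
      fd (\<lambda>p. (- ((f (fst p) * K (snd p) v w) *\<^sub>R N (fst p)), christoffel K (snd p) v w)) (x, y)"
    by (rule fd_cong_open[OF open_UV])
       (use x y in \<open>auto simp: christoffel_W fd_f_zero\<close>)
  also have "\<dots> = ?R"
    by (rule fd_eqI)
      (auto intro!: derivative_eq_intros d1 d2 d3 d4 ext simp: algebra_simps)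
  finally show ?thesis by simp
qed

end

lemma sum_Basis_prod:
  "(\<Sum>i\<in>(Basis :: ('e::euclidean_space \<times> 'd::euclidean_space) set). \<phi> i)
     = (\<Sum>i\<in>Basis. \<phi> (i, 0)) + (\<Sum>j\<in>Basis. \<phi> (0, j))"
  unfolding Basis_prod_def
  by (subst sum.union_disjoint) (auto simp: sum.reindex inj_on_def)

context warped_chart begin

text \<open>
  The scalar curvature only involves the Ricci tensor on two horizontal or two vertical vectors,
  because the inverse metric is block diagonal.  The trace defining the Ricci tensor runs over both
  factors, hence the four components of the curvature tensor that follow.
\<close>

lemma riemann_W_horizontal:
  assumes x: "x \<in> U" and y: "y \<in> V"
  shows "riemann W (x, y) (u, 0) (v, 0) (w, 0) = (riemann G x u v w, 0)"
  unfolding riemann_def fd_christoffel_W_horizontal[OF x y]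
  using x y by (simp add: christoffel_W bilinear_lzero[OF F.bilinear_G])

lemma riemann_W_vertical_horizontal:
  assumes x: "x \<in> U" and y: "y \<in> V"
  shows "riemann W (x, y) (0, u) (v, 0) (w, 0) = (0, - (hess G f x v w / f x) *\<^sub>R u)"
proof -
  have "riemann W (x, y) (0, u) (v, 0) (w, 0) =
    (0, - ((fd (\<lambda>t. fd f t w) x v / f x - fd f x w * fd f x v / (f x)\<^sup>2)
       - fd f x (christoffel G x v w) / f x + (fd f x w / f x) * (fd f x v / f x)) *\<^sub>R u)"
    unfolding riemann_def fd_christoffel_W_horizontal[OF x y] fd_christoffel_W_mixed[OF x y]
    using x y linear_0[OF linear_frechet_derivative[OF B.christoffel_differentiable[OF x]]]
    by (simp add: christoffel_W bilinear_lzero[OF F.bilinear_G] bilinear_rzero[OF F.bilinear_G] algebra_simps)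
  also have "\<dots> = (0, - (hess G f x v w / f x) *\<^sub>R u)"
    unfolding hess_def by (simp add: diff_divide_distrib power2_eq_square)
  finally show ?thesis .
qed

text \<open>
  The Hessian appears here as the endomorphism \<open>u \<mapsto> \<nabla>\<^sub>u (gradient f)\<close>, whose trace is the Laplacian.
\<close>

lemma fst_riemann_W_horizontal_vertical:
  assumes x: "x \<in> U" and y: "y \<in> V"
  shows "fst (riemann W (x, y) (u, 0) (0, v) (0, w)) =
    - (f x * K y v w) *\<^sub>R (fd N x u + christoffel G x u (N x))"
proof -
  have c: "christoffel G x u (- (f x * K y v w) *\<^sub>R N x) = - (f x * K y v w) *\<^sub>R christoffel G x u (N x)"
    by (rule B.christoffel_scale_right[OF x])
  show ?thesis
    unfolding riemann_def fd_christoffel_W_vertical[OF x y] fd_christoffel_W_mixed[OF x y]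
    using x y f_pos[OF x] c linear_0[OF F.linear_fd_G[OF y]]
    by (simp add: christoffel_W fd_f_zero bilinear_lzero[OF F.bilinear_G] bilinear_rmul[OF F.bilinear_G]
        algebra_simps)
qed

text \<open>
  The Gauss equation of the fibres: they are umbilic with mean curvature vector
  \<open>- gradient f / f\<close>, so the curvature of the fibre is corrected by a term of constant curvature type.
\<close>

lemma snd_riemann_W_vertical:
  assumes x: "x \<in> U" and y: "y \<in> V"
  shows "snd (riemann W (x, y) (0, u) (0, v) (0, w)) =
    riemann K y u v w - fd f x (N x) *\<^sub>R (K y v w *\<^sub>R u - K y u w *\<^sub>R v)"
proof -
  have n: "fd f x (- (r *\<^sub>R N x)) = - r * fd f x (N x)" for r
    by (simp add: linear_neg[OF linear_fd_f[OF x]] linear_cmul[OF linear_fd_f[OF x]])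
  show ?thesis
    unfolding riemann_def fd_christoffel_W_vertical[OF x y]
    using x y f_pos[OF x]
    by (simp add: christoffel_W fd_f_zero n algebra_simps)
qed

lemma ricci_W_horizontal:
  assumes x: "x \<in> U" and y: "y \<in> V"
  shows "ricci W (x, y) (v, 0) (w, 0) = ricci G x v w - DIM('d) * hess G f x v w / f x"
  unfolding ricci_def sum_Basis_prod
  by (simp add: riemann_W_horizontal[OF x y] riemann_W_vertical_horizontal[OF x y])

text \<open>
  The correction by \<open>DIM('d) - 1\<close> comes from the trace of \<open>u \<mapsto> K(v, w) u - K(u, w) v\<close>.
\<close>

lemma ricci_W_vertical:
  assumes x: "x \<in> U" and y: "y \<in> V"
  shows "ricci W (x, y) (0, v) (0, w) = ricci K y v w
    - (f x * B.laplacian f x + (real DIM('d) - 1) * fd f x (N x)) * K y v w"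
proof -
  have 1: "(\<Sum>i\<in>Basis. riemann W (x, y) (i, 0) (0, v) (0, w) \<bullet> (i, 0)) = - (f x * K y v w) * B.laplacian f x"
    unfolding B.divergence_gradient[OF twice_differentiable_f x, symmetric]
    by (simp add: inner_prod_def fst_riemann_W_horizontal_vertical[OF x y] sum_distrib_left sum_negf)
  have l: "linear (\<lambda>u. K y u w)" using F.bilinear_G[OF y] by (simp add: bilinear_def)
  have "(\<Sum>j\<in>Basis. riemann W (x, y) (0, j) (0, v) (0, w) \<bullet> (0, j)) =
     (\<Sum>j\<in>Basis. riemann K y j v w \<bullet> j) - fd f x (N x) * ((\<Sum>j\<in>(Basis::'d set). K y v w) - (\<Sum>j\<in>Basis. (v \<bullet> j) * K y j w))"
    by (simp add: inner_prod_def snd_riemann_W_vertical[OF x y] inner_diff_left sum_subtractf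
        sum_distrib_left right_diff_distrib mult_ac)
  also have "(\<Sum>j\<in>Basis. (v \<bullet> j) * K y j w) = K y v w"
    using linear_expansion[OF l, of v] by simp
  finally show ?thesis
    unfolding ricci_def sum_Basis_prod 1 by (simp add: algebra_simps)
qed

lemma sharp_W:
  assumes x: "x \<in> U" and y: "y \<in> V"
  shows "sharp (W (x, y)) (\<lambda>w. w \<bullet> (i, 0)) = (sharp (G x) (\<lambda>w. w \<bullet> i), 0)"
    and "sharp (W (x, y)) (\<lambda>w. w \<bullet> (0, j)) = (0, (1 / (f x)\<^sup>2) *\<^sub>R sharp (K y) (\<lambda>w. w \<bullet> j))"
  using f_pos[OF x]
  by (intro sharp_eqI bilinear_W nondegenerate_W x y;
      simp add: warped_form_def inner_prod_def B.G_sharp[OF x linear_inner_right_arg]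
        F.G_sharp[OF y linear_inner_right_arg] bilinear_lzero[OF F.bilinear_G[OF y]]
        bilinear_lzero[OF B.bilinear_G[OF x]] bilinear_lmul[OF F.bilinear_G[OF y]])+

text \<open>
  The Laplacian of \<open>f\<close> enters twice, once from the horizontal Ricci tensor and once, through
  \<open>K\<close>-trace \<open>DIM('d)\<close>, from the vertical one.
\<close>

lemma scalar_curv_W:
  assumes x: "x \<in> U" and y: "y \<in> V"
  shows "scalar_curv W (x, y) = scalar_curv G x + scalar_curv K y / (f x)\<^sup>2
    - 2 * DIM('d) * B.laplacian f x / f x
    - DIM('d) * (real DIM('d) - 1) * fd f x (N x) / (f x)\<^sup>2"
proof -
  note im = inverse_metric_def sharp_W[OF x y]
  have h: "(\<Sum>i\<in>Basis. \<Sum>j\<in>Basis. inverse_metric (W (x, y)) (i, 0) (j, 0) * ricci W (x, y) (i, 0) (j, 0))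
      = scalar_curv G x - DIM('d) * B.laplacian f x / f x"
    unfolding scalar_curv_def B.laplacian_def ricci_W_horizontal[OF x y]
    by (simp add: im right_diff_distrib sum_subtractf sum_distrib_left sum_divide_distrib mult_ac)
  let ?c = "f x * B.laplacian f x + (real DIM('d) - 1) * fd f x (N x)"
  have "(\<Sum>i\<in>Basis. \<Sum>j\<in>Basis. inverse_metric (W (x, y)) (0, i) (0, j) * ricci W (x, y) (0, i) (0, j))
      = (\<Sum>i\<in>Basis. \<Sum>j\<in>Basis. (inverse_metric (K y) i j * ricci K y i j
          - ?c * (inverse_metric (K y) i j * K y i j)) / (f x)\<^sup>2)"
    unfolding ricci_W_vertical[OF x y]
    by (simp add: im algebra_simps diff_divide_distrib add_divide_distrib)
  also have "\<dots> = (scalar_curv K y - ?c * DIM('d)) / (f x)\<^sup>2"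
    unfolding scalar_curv_def F.trace_metric[OF y, symmetric]
    by (simp only: sum_divide_distrib[symmetric] sum_subtractf sum_distrib_left[symmetric])
  finally have v: "(\<Sum>i\<in>Basis. \<Sum>j\<in>Basis. inverse_metric (W (x, y)) (0, i) (0, j) * ricci W (x, y) (0, i) (0, j))
      = (scalar_curv K y - ?c * DIM('d)) / (f x)\<^sup>2" .
  have m: "inverse_metric (W (x, y)) (i, 0) (0, j) = 0" "inverse_metric (W (x, y)) (0, j) (i, 0) = 0" for i j
    by (simp_all add: im)
  have "scalar_curv W (x, y) = scalar_curv G x - DIM('d) * B.laplacian f x / f x
     + (scalar_curv K y - ?c * DIM('d)) / (f x)\<^sup>2"
    unfolding scalar_curv_def[of W] sum_Basis_prod m by (simp add: h v sum.distrib)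
  moreover have "(scalar_curv K y - ?c * DIM('d)) / (f x)\<^sup>2 = scalar_curv K y / (f x)\<^sup>2
      - DIM('d) * B.laplacian f x / f x - DIM('d) * (real DIM('d) - 1) * fd f x (N x) / (f x)\<^sup>2"
    using f_pos[OF x] by (simp add: divide_simps) (simp add: algebra_simps power2_eq_square)
  ultimately show ?thesis by simp
qed

text \<open>
  A function pulled back from the base has no second derivatives along the fibre; its vertical
  Hessian is the derivative along the normal part of the connection.
\<close>

lemma hess_W_vertical:
  assumes x: "x \<in> U" and y: "y \<in> V" and h: "\<And>t. t \<in> U \<Longrightarrow> h differentiable (at t)"
  shows "hess W (\<lambda>p. h (fst p)) (x, y) (0, v) (0, w) = f x * fd h x (N x) * K y v w"
proof -
  have d: "fd (\<lambda>p. h (fst p)) q = (\<lambda>k. fd h (fst q) (fst k))" if "q \<in> U \<times> V" for q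
    using that h by (intro fd_eqI has_derivative_compose_fst) auto
  have l: "linear (fd h t)" if "t \<in> U" for t
    using h[OF that] by (rule linear_frechet_derivative)
  have "fd (\<lambda>q. fd (\<lambda>p. h (fst p)) q (0, w)) (x, y) = fd (\<lambda>q. 0) (x, y)"
    by (rule fd_cong_open[OF open_UV]) (use x y in \<open>auto simp: d linear_0[OF l]\<close>)
  moreover have "fd h x (- ((f x * K y v w) *\<^sub>R N x)) = - (f x * K y v w) * fd h x (N x)"
    by (simp add: linear_neg[OF l[OF x]] linear_cmul[OF l[OF x]])
  ultimately show ?thesis
    unfolding hess_def using x y by (simp add: d christoffel_W)
qed

end

section \<open>The strong maximum principle\<close>

text \<open>
  Fejer's trace inequality, by completing the square: with the pivot \<open>a k k > 0\<close>, the matrix \<open>a\<close> is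
  the sum of the rank one matrix \<open>a i k * a j k / a k k\<close>, on which the claim is the assumption on
  \<open>m\<close> for the vector \<open>a i k\<close>, and of its Schur complement, which is positive definite in the
  remaining variables.
\<close>

lemma trace_product_nonpos:
  fixes a m :: "'i \<Rightarrow> 'i \<Rightarrow> real"
  assumes "finite I" "\<And>i j. i \<in> I \<Longrightarrow> j \<in> I \<Longrightarrow> a i j = a j i"
    and "\<And>c. (\<exists>i\<in>I. c i \<noteq> 0) \<Longrightarrow> (\<Sum>i\<in>I. \<Sum>j\<in>I. c i * c j * a i j) > 0"
    and "\<And>c. (\<Sum>i\<in>I. \<Sum>j\<in>I. c i * c j * m i j) \<le> 0"
  shows "(\<Sum>i\<in>I. \<Sum>j\<in>I. a i j * m i j) \<le> 0"
  using assms
proof (induction I arbitrary: a rule: finite_induct)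
  case empty
  then show ?case by simp
next
  case (insert k I)
  note sym = insert.prems(1) and pos = insert.prems(2) and neg = insert.prems(3)
  have split: "(\<Sum>i\<in>insert k I. \<Sum>j\<in>insert k I. p i j) =
      p k k + (\<Sum>j\<in>I. p k j) + (\<Sum>i\<in>I. p i k) + (\<Sum>i\<in>I. \<Sum>j\<in>I. p i j)" for p :: "'i \<Rightarrow> 'i \<Rightarrow> real"
    using insert.hyps by (simp add: sum.distrib)
  have kk: "a k k > 0"
  proof -
    have "(\<Sum>i\<in>insert k I. \<Sum>j\<in>insert k I. (if i = k then 1 else 0) * (if j = k then 1 else 0) * a i j) > 0"
      by (rule pos) auto
    moreover have "(\<Sum>i\<in>I. (if i = k then 1 else 0) * g i) = 0" for g :: "'i \<Rightarrow> real"
      using insert.hyps by (intro sum.neutral) auto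
    ultimately show ?thesis unfolding split using insert.hyps
      by (simp add: sum.neutral if_distrib[of "\<lambda>t. t * _"] cong: if_cong)
  qed
  define a' where "a' i j = a i j - a i k * a j k / a k k" for i j
  have "(\<Sum>i\<in>I. \<Sum>j\<in>I. a' i j * m i j) \<le> 0"
  proof (rule insert.IH)
    show "a' i j = a' j i" if "i \<in> I" "j \<in> I" for i j
      using sym[of i j] that by (simp add: a'_def)
    show "0 < (\<Sum>i\<in>I. \<Sum>j\<in>I. c i * c j * a' i j)" if c: "\<exists>i\<in>I. c i \<noteq> 0" for c
    proof -
      define s where "s = (\<Sum>i\<in>I. c i * a i k)"
      \<comment> \<open>Choosing the \<open>k\<close>-th entry so as to minimise the quadratic form of \<open>a\<close> gives that of \<open>a'\<close>.\<close>
      define c' where "c' = c(k := - s / a k k)"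
      have c'I: "c' i = c i" if "i \<in> I" for i using that insert.hyps by (auto simp: c'_def)
      have c'k: "c' k = - s / a k k" by (simp add: c'_def)
      have "0 < (\<Sum>i\<in>insert k I. \<Sum>j\<in>insert k I. c' i * c' j * a i j)"
        using c c'I by (intro pos) auto
      also have "\<dots> = c' k * c' k * a k k + (\<Sum>j\<in>I. c' k * (c j * a j k)) + (\<Sum>i\<in>I. c' k * (c i * a i k))
          + (\<Sum>i\<in>I. \<Sum>j\<in>I. c i * c j * a i j)"
      proof -
        have "(\<Sum>j\<in>I. c' k * c' j * a k j) = (\<Sum>j\<in>I. c' k * (c j * a j k))"
          using sym by (intro sum.cong) (simp_all add: c'I)
        moreover have "(\<Sum>i\<in>I. c' i * c' k * a i k) = (\<Sum>i\<in>I. c' k * (c i * a i k))"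
          by (intro sum.cong) (simp_all add: c'I)
        moreover have "(\<Sum>i\<in>I. \<Sum>j\<in>I. c' i * c' j * a i j) = (\<Sum>i\<in>I. \<Sum>j\<in>I. c i * c j * a i j)"
          by (intro sum.cong) (simp_all add: c'I)
        ultimately show ?thesis by (simp only: split)
      qed
      also have "\<dots> = (\<Sum>i\<in>I. \<Sum>j\<in>I. c i * c j * a i j) - s * s / a k k"
      proof -
        have "(\<Sum>j\<in>I. c' k * (c j * a j k)) = c' k * s" by (simp only: sum_distrib_left s_def)
        then show ?thesis using kk by (simp add: c'k field_simps)
      qed
      also have "s * s / a k k = (\<Sum>i\<in>I. \<Sum>j\<in>I. c i * c j * (a i k * a j k / a k k))"
        by (simp add: s_def sum_product sum_divide_distrib mult_ac)
      finally show ?thesis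
        by (simp add: a'_def right_diff_distrib sum_subtractf)
    qed
    show "(\<Sum>i\<in>I. \<Sum>j\<in>I. c i * c j * m i j) \<le> 0" for c
    proof -
      have "(\<Sum>i\<in>I. \<Sum>j\<in>I. c i * c j * m i j) =
          (\<Sum>i\<in>insert k I. \<Sum>j\<in>insert k I. (c(k := 0)) i * (c(k := 0)) j * m i j)"
        unfolding split using insert.hyps by (auto intro!: sum.cong)
      then show ?thesis using neg[of "c(k := 0)"] by simp
    qed
  qed
  moreover have "(\<Sum>i\<in>insert k I. \<Sum>j\<in>insert k I. a' i j * m i j) = (\<Sum>i\<in>I. \<Sum>j\<in>I. a' i j * m i j)"
    unfolding split using kk sym by (simp add: a'_def)
  moreover have "(\<Sum>i\<in>insert k I. \<Sum>j\<in>insert k I. a i k * a j k * m i j) / a k k \<le> 0"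
    using neg[of "\<lambda>i. a i k"] kk by (simp add: divide_nonpos_pos)
  moreover have "(\<Sum>i\<in>insert k I. \<Sum>j\<in>insert k I. a i j * m i j) =
      (\<Sum>i\<in>insert k I. \<Sum>j\<in>insert k I. a i k * a j k * m i j) / a k k
      + (\<Sum>i\<in>insert k I. \<Sum>j\<in>insert k I. a' i j * m i j)"
    unfolding sum_divide_distrib sum.distrib[symmetric]
    by (intro sum.cong refl) (simp add: a'_def algebra_simps)
  ultimately show ?case by linarith
qed

text \<open>
  A positive second derivative along \<open>v\<close> makes the first derivative positive just after \<open>\<xi>\<close>, and
  by the mean value theorem the function increases above its maximum.
\<close>

lemma local_max_second_derivative:
  fixes \<Phi> :: "'e::euclidean_space \<Rightarrow> real"
  assumes S: "open S" "\<xi> \<in> S" and d: "\<And>y. y \<in> S \<Longrightarrow> \<Phi> differentiable (at y)"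
    and d2: "(\<lambda>y. fd \<Phi> y v) differentiable (at \<xi>)"
    and max: "\<And>y. y \<in> S \<Longrightarrow> \<Phi> y \<le> \<Phi> \<xi>"
  shows "fd \<Phi> \<xi> v = 0" and "fd (\<lambda>y. fd \<Phi> y v) \<xi> v \<le> 0"
proof -
  have "fd \<Phi> \<xi> = (\<lambda>v. 0)"
    by (rule differential_zero_maxmin[OF S(2,1) has_derivative_fd[OF d[OF S(2)]]]) (use max in auto)
  then show z: "fd \<Phi> \<xi> v = 0" for v by simp
  define line where "line t = \<xi> + t *\<^sub>R v" for t :: real
  have line: "(line has_derivative (\<lambda>h. h *\<^sub>R v)) (at t)" for t
    unfolding line_def by (auto intro!: derivative_eq_intros)
  have "isCont line 0" using line has_derivative_continuous by blast
  then have "\<forall>\<^sub>F t in nhds 0. line t \<in> S"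
    using S by (simp add: continuous_at_open eventually_nhds line_def)
  then obtain e where e: "e > 0" "\<And>t. \<bar>t\<bar> < e \<Longrightarrow> line t \<in> S"
    by (auto simp: eventually_nhds_metric dist_real_def)
  have D1: "((\<lambda>t. \<Phi> (line t)) has_real_derivative fd \<Phi> (line t) v) (at t)" if "\<bar>t\<bar> < e" for t
  proof -
    note dl = has_derivative_fd[OF d[OF e(2)[OF that]]]
    have "((\<lambda>t. \<Phi> (line t)) has_derivative (\<lambda>h. fd \<Phi> (line t) (h *\<^sub>R v))) (at t)"
      by (rule has_derivative_compose[where g = \<Phi>, OF line dl])
    then show ?thesis
      by (simp add: has_field_derivative_def linear_cmul[OF has_derivative_linear[OF dl]] mult.commute[of _ "fd \<Phi> (line t) v"])
  qed
  have l0: "line 0 = \<xi>" by (simp add: line_def)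
  note dl = has_derivative_fd[OF d2]
  have "((\<lambda>t. fd \<Phi> (line t) v) has_derivative (\<lambda>h. fd (\<lambda>y. fd \<Phi> y v) \<xi> (h *\<^sub>R v))) (at 0)"
    by (rule has_derivative_compose[where g = "\<lambda>y. fd \<Phi> y v", OF line]) (simp add: l0 dl)
  then have D2: "((\<lambda>t. fd \<Phi> (line t) v) has_real_derivative fd (\<lambda>y. fd \<Phi> y v) \<xi> v) (at 0)"
    by (simp add: has_field_derivative_def linear_cmul[OF has_derivative_linear[OF dl]] mult.commute[of _ "fd (\<lambda>y. fd \<Phi> y v) \<xi> v"])
  show "fd (\<lambda>y. fd \<Phi> y v) \<xi> v \<le> 0"
  proof (rule ccontr)
    assume "\<not> ?thesis"
    then obtain r where r: "r > 0" "\<And>h. h > 0 \<Longrightarrow> h < r \<Longrightarrow> fd \<Phi> (line 0) v < fd \<Phi> (line (0 + h)) v"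
      using DERIV_pos_inc_right[OF D2] by (metis add_0 not_le)
    define s where "s = min e r / 2"
    have s: "0 < s" "s < e" "s < r" using e r by (auto simp: s_def)
    obtain t where t: "0 < t" "t < s" "\<Phi> (line s) - \<Phi> (line 0) = (s - 0) * fd \<Phi> (line t) v"
      using MVT2[of 0 s "\<lambda>t. \<Phi> (line t)" "\<lambda>t. fd \<Phi> (line t) v"] s D1 by (metis abs_of_nonneg le_less_trans)
    have "fd \<Phi> (line t) v > 0" using r(2)[of t] t s z by (simp add: l0)
    then have "(s - 0) * fd \<Phi> (line t) v > 0" using s by simp
    then have "\<Phi> (line s) > \<Phi> \<xi>" using t(3) by (simp only: l0)
    moreover have "line s \<in> S" using e(2)[of s] s by simp
    ultimately show False using max[of "line s"] by simp
  qed
qed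

text \<open>
  Positive definiteness and continuity of the coefficients give uniform ellipticity and bounded
  coefficients on compact subsets, where Hopf's barrier is built.
\<close>

locale elliptic_operator =
  fixes U :: "'e::euclidean_space set" and a :: "'e \<Rightarrow> 'e \<Rightarrow> 'e \<Rightarrow> real" and b :: "'e \<Rightarrow> 'e"
  assumes open_U: "open U"
    and a_sym: "x \<in> U \<Longrightarrow> i \<in> Basis \<Longrightarrow> j \<in> Basis \<Longrightarrow> a x i j = a x j i"
    and a_pos: "x \<in> U \<Longrightarrow> v \<noteq> 0 \<Longrightarrow> (\<Sum>i\<in>Basis. \<Sum>j\<in>Basis. (v \<bullet> i) * (v \<bullet> j) * a x i j) > 0"
    and a_cont: "i \<in> Basis \<Longrightarrow> j \<in> Basis \<Longrightarrow> continuous_on U (\<lambda>x. a x i j)"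
    and b_cont: "continuous_on U b"
begin

definition L :: "('e \<Rightarrow> real) \<Rightarrow> 'e \<Rightarrow> real" where
  "L u x = (\<Sum>i\<in>Basis. \<Sum>j\<in>Basis. a x i j * fd (\<lambda>y. fd u y j) x i) + fd u x (b x)"

lemma L_nonpos_at_max:
  assumes "open S" "S \<subseteq> U" and S: "\<xi> \<in> S"
    and tw: "twice_differentiable_on S \<Phi>" and max: "\<And>y. y \<in> S \<Longrightarrow> \<Phi> y \<le> \<Phi> \<xi>"
  shows "L \<Phi> \<xi> \<le> 0"
proof -
  have d: "\<Phi> differentiable (at y)" "(\<lambda>t. fd \<Phi> t v) differentiable (at y)" if "y \<in> S" for y v
    using tw that by (auto simp: twice_differentiable_on_def)
  note test = local_max_second_derivative[OF \<open>open S\<close> S d(1) d(2)[OF S] max]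
  have U: "\<xi> \<in> U" using assms by blast
  define m where "m i j = fd (\<lambda>y. fd \<Phi> y j) \<xi> i" for i j
  have l: "linear (\<lambda>i. m i j)" for j
    unfolding m_def by (rule linear_frechet_derivative[OF d(2)[OF S]])
  have "(\<Sum>i\<in>Basis. \<Sum>j\<in>Basis. a \<xi> i j * m i j) \<le> 0"
  proof (rule trace_product_nonpos)
    show "0 < (\<Sum>i\<in>Basis. \<Sum>j\<in>Basis. c i * c j * a \<xi> i j)" if c: "\<exists>i\<in>Basis. c i \<noteq> 0" for c
    proof -
      define v where "v = (\<Sum>i\<in>Basis. c i *\<^sub>R i)"
      have vi: "v \<bullet> i = c i" if "i \<in> Basis" for i using that by (simp add: v_def)
      then have "v \<noteq> 0" using c by force
      from a_pos[OF U this] show ?thesis by (simp add: vi)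
    qed
    show "(\<Sum>i\<in>Basis. \<Sum>j\<in>Basis. c i * c j * m i j) \<le> 0" for c
    proof -
      define v where "v = (\<Sum>i\<in>Basis. c i *\<^sub>R i)"
      have "fd (\<lambda>y. fd \<Phi> y v) \<xi> = fd (\<lambda>y. \<Sum>j\<in>Basis. c j * fd \<Phi> y j) \<xi>"
      proof (rule fd_cong_open[OF \<open>open S\<close> S])
        fix y assume y: "y \<in> S"
        show "fd \<Phi> y v = (\<Sum>j\<in>Basis. c j * fd \<Phi> y j)"
          using linear_expansion[OF linear_frechet_derivative[OF d(1)[OF y]], of v] by (simp add: v_def)
      qed
      also have "\<dots> = (\<lambda>h. \<Sum>j\<in>Basis. c j * m h j)"
        unfolding m_def
        by (intro fd_eqI has_derivative_sum has_derivative_mult_right has_derivative_fd d S)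
      finally have "fd (\<lambda>y. fd \<Phi> y v) \<xi> v = (\<Sum>j\<in>Basis. c j * m v j)" by simp
      also have "\<dots> = (\<Sum>j\<in>Basis. \<Sum>i\<in>Basis. c i * c j * m i j)"
        by (intro sum.cong refl, subst linear_expansion[OF l]) (simp add: v_def sum_distrib_left mult_ac)
      also have "\<dots> = (\<Sum>i\<in>Basis. \<Sum>j\<in>Basis. c i * c j * m i j)" by (rule sum.swap)
      finally show ?thesis using test(2)[of v] by simp
    qed
  qed (use a_sym[OF U] in auto)
  then show ?thesis using test(1) by (simp add: L_def m_def)
qed

text \<open>
  Hopf's barrier: it vanishes on the sphere of radius \<open>R\<close> around \<open>c\<close>, is positive inside and
  negative outside.  For large \<open>\<alpha>\<close> the second-order term, quadratic in \<open>\<alpha>\<close>, dominates away from the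
  centre, so that the barrier is a strict subsolution there.
\<close>

definition barrier :: "real \<Rightarrow> 'e \<Rightarrow> real \<Rightarrow> 'e \<Rightarrow> real" where
  "barrier \<alpha> c R z = exp (- \<alpha> * ((z - c) \<bullet> (z - c))) - exp (- \<alpha> * R\<^sup>2)"

lemma barrier_derivative:
  "(barrier \<alpha> c R has_derivative
     (\<lambda>h. - 2 * \<alpha> * ((z - c) \<bullet> h) * exp (- \<alpha> * ((z - c) \<bullet> (z - c))))) (at z)"
  unfolding barrier_def[abs_def]
  by (auto intro!: derivative_eq_intros ext simp: inner_commute algebra_simps)

lemma barrier_second_derivative:
  "((\<lambda>y. fd (barrier \<alpha> c R) y j) has_derivative
     (\<lambda>h. (4 * \<alpha>\<^sup>2 * ((z - c) \<bullet> h) * ((z - c) \<bullet> j) - 2 * \<alpha> * (h \<bullet> j))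
        * exp (- \<alpha> * ((z - c) \<bullet> (z - c))))) (at z)"
  unfolding fd_eqI[OF barrier_derivative]
  by (auto intro!: derivative_eq_intros ext simp: inner_commute algebra_simps power2_eq_square)

lemma twice_differentiable_barrier: "twice_differentiable_on S (barrier \<alpha> c R)"
  unfolding twice_differentiable_on_def
  using barrier_derivative barrier_second_derivative differentiableI by blast

lemma L_barrier:
  "L (barrier \<alpha> c R) z = exp (- \<alpha> * ((z - c) \<bullet> (z - c))) *
     (4 * \<alpha>\<^sup>2 * (\<Sum>i\<in>Basis. \<Sum>j\<in>Basis. ((z - c) \<bullet> i) * ((z - c) \<bullet> j) * a z i j)
      - 2 * \<alpha> * ((\<Sum>i\<in>Basis. \<Sum>j\<in>Basis. a z i j * (i \<bullet> j)) + (z - c) \<bullet> b z))"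
proof -
  let ?E = "exp (- \<alpha> * ((z - c) \<bullet> (z - c)))"
  let ?Q = "\<Sum>i\<in>Basis. \<Sum>j\<in>Basis. ((z - c) \<bullet> i) * ((z - c) \<bullet> j) * a z i j"
  let ?T = "\<Sum>i\<in>Basis. \<Sum>j\<in>Basis. a z i j * (i \<bullet> j)"
  have alg: "4 * \<alpha>\<^sup>2 * E * Q - 2 * \<alpha> * E * T + - 2 * \<alpha> * t * E = E * (4 * \<alpha>\<^sup>2 * Q - 2 * \<alpha> * (T + t))"
    for E Q T t :: real by (simp add: algebra_simps)
  have "(\<Sum>i\<in>Basis. \<Sum>j\<in>Basis. a z i j *
        ((4 * \<alpha>\<^sup>2 * ((z - c) \<bullet> i) * ((z - c) \<bullet> j) - 2 * \<alpha> * (i \<bullet> j)) * ?E)) =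
      (\<Sum>i\<in>Basis. \<Sum>j\<in>Basis. 4 * \<alpha>\<^sup>2 * ?E * (((z - c) \<bullet> i) * ((z - c) \<bullet> j) * a z i j)
        - 2 * \<alpha> * ?E * (a z i j * (i \<bullet> j)))"
    by (intro sum.cong refl) (simp only: left_diff_distrib right_diff_distrib mult_ac)
  also have "\<dots> = 4 * \<alpha>\<^sup>2 * ?E * ?Q - 2 * \<alpha> * ?E * ?T"
    by (simp only: sum_subtractf sum_distrib_left)
  finally show ?thesis
    unfolding L_def fd_eqI[OF barrier_second_derivative] unfolding fd_eqI[OF barrier_derivative]
    by (simp only: alg)
qed

lemma L_barrier_pos:
  assumes C: "compact C" "C \<subseteq> U" "c \<notin> C"
  obtains \<alpha> where "\<alpha> > 0" "\<And>z R. z \<in> C \<Longrightarrow> L (barrier \<alpha> c R) z > 0"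
proof (cases "C = {}")
  case False
  define Q where "Q z = (\<Sum>i\<in>Basis. \<Sum>j\<in>Basis. ((z - c) \<bullet> i) * ((z - c) \<bullet> j) * a z i j)" for z
  define T where "T z = (\<Sum>i\<in>Basis. \<Sum>j\<in>Basis. a z i j * (i \<bullet> j)) + (z - c) \<bullet> b z" for z
  have ca: "continuous_on C (\<lambda>z. a z i j)" if "i \<in> Basis" "j \<in> Basis" for i j
    using a_cont[OF that] C(2) continuous_on_subset by blast
  have cb: "continuous_on C b" using b_cont C(2) continuous_on_subset by blast
  have "continuous_on C Q" unfolding Q_def by (intro continuous_intros ca)
  then obtain z0 where z0: "z0 \<in> C" "\<And>z. z \<in> C \<Longrightarrow> Q z0 \<le> Q z"
    using continuous_attains_inf[OF C(1) False] by blast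
  have "continuous_on C T" unfolding T_def by (intro continuous_intros ca cb)
  then obtain z1 where z1: "z1 \<in> C" "\<And>z. z \<in> C \<Longrightarrow> T z \<le> T z1"
    using continuous_attains_sup[OF C(1) False] by blast
  have q: "Q z0 > 0"
    unfolding Q_def using z0 C by (intro a_pos) auto
  \<comment> \<open>This makes \<open>4 \<alpha>\<^sup>2 Q > 2 \<alpha> T\<close> on all of \<open>C\<close>.\<close>
  define \<alpha> where "\<alpha> = (\<bar>T z1\<bar> + 1) / Q z0"
  have \<alpha>: "\<alpha> > 0" "\<alpha> * Q z0 = \<bar>T z1\<bar> + 1" using q by (auto simp: \<alpha>_def)
  show ?thesis
  proof (rule that[OF \<alpha>(1)])
    fix z R assume z: "z \<in> C"
    have "\<alpha> * Q z \<ge> \<bar>T z1\<bar> + 1" using \<alpha> z0(2)[OF z] by (metis mult_left_mono less_imp_le)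
    then have "2 * (\<alpha> * Q z) - T z > 0" using z1(2)[OF z] by linarith
    then have "2 * \<alpha> * (2 * (\<alpha> * Q z) - T z) > 0" using \<alpha>(1) by simp
    then show "L (barrier \<alpha> c R) z > 0"
      unfolding L_barrier Q_def[symmetric] T_def[symmetric]
      by (intro mult_pos_pos) (simp_all add: algebra_simps power2_eq_square)
  qed
qed (use that[of 1] in simp)

text \<open>
  If a ball met the set where \<open>u\<close> takes its maximum only in its boundary point \<open>y\<close>, then adding a
  small multiple of the barrier would give a function with an interior maximum in a small ball
  around \<open>y\<close>: on the boundary of the small ball it is less than \<open>m\<close>, inside the touching ball because
  \<open>u\<close> is less than \<open>m\<close> there by a fixed amount, outside because the barrier is negative.  But it is a
  strict subsolution, and at an interior maximum the operator is nonpositive.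
\<close>

lemma no_touching_ball:
  assumes u: "twice_differentiable_on U u" and Lu: "\<And>z. z \<in> U \<Longrightarrow> L u z \<ge> 0"
    and max: "\<And>z. z \<in> U \<Longrightarrow> u z \<le> m" and y: "y \<in> U" "u y = m"
    and R: "R > 0" "dist c y = R"
    and touch: "\<And>z. z \<in> cball c R \<Longrightarrow> z \<noteq> y \<Longrightarrow> u z < m"
  shows False
proof -
  obtain \<delta>0 where \<delta>0: "\<delta>0 > 0" "cball y \<delta>0 \<subseteq> U"
    using open_U y open_contains_cball by blast
  define \<delta> where "\<delta> = min \<delta>0 (R / 2)"
  have \<delta>: "\<delta> > 0" "\<delta> < R" "cball y \<delta> \<subseteq> U" using \<delta>0 R by (auto simp: \<delta>_def)
  have "c \<notin> cball y \<delta>" using \<delta> R by (simp add: dist_commute)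
  then obtain \<alpha> where \<alpha>: "\<alpha> > 0" "\<And>z R. z \<in> cball y \<delta> \<Longrightarrow> L (barrier \<alpha> c R) z > 0"
    using L_barrier_pos[OF compact_cball \<delta>(3)] by blast
  let ?w = "barrier \<alpha> c R"
  have du: "u differentiable (at z)" "(\<lambda>t. fd u t v) differentiable (at z)" if "z \<in> U" for z v
    using u that by (auto simp: twice_differentiable_on_def)
  have dw: "?w differentiable (at z)" "(\<lambda>t. fd ?w t v) differentiable (at z)" for z v
    using twice_differentiable_barrier[of UNIV] by (auto simp: twice_differentiable_on_def)
  have cu: "continuous_on U u"
    using du(1) differentiable_imp_continuous_within by (intro continuous_at_imp_continuous_on) blast
  have cw: "continuous_on S ?w" for S
    using dw(1) differentiable_imp_continuous_within by (intro continuous_at_imp_continuous_on) blast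
  define P where "P = sphere y \<delta> \<inter> cball c R"
  have P: "compact P" "P \<subseteq> U" using \<delta>(3) by (auto simp: P_def compact_Int_closed)
  have uP: "u z < m" if "z \<in> P" for z
    using that \<delta>(1) by (intro touch) (auto simp: P_def)
  obtain \<eta> where \<eta>: "\<eta> > 0" "\<And>z. z \<in> P \<Longrightarrow> u z \<le> m - \<eta>"
  proof (cases "P = {}")
    case False
    obtain z0 where z0: "z0 \<in> P" "\<And>z. z \<in> P \<Longrightarrow> u z \<le> u z0"
      using continuous_attains_sup[OF P(1) False continuous_on_subset[OF cu P(2)]] by blast
    show ?thesis by (rule that[of "m - u z0"]) (use uP z0 in auto)
  qed (use that[of 1] in simp)
  define \<Phi> where "\<Phi> = (\<lambda>z. u z + \<eta> * ?w z)"
  have "continuous_on (cball y \<delta>) \<Phi>"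
    unfolding \<Phi>_def by (intro continuous_intros cw continuous_on_subset[OF cu \<delta>(3)])
  then obtain \<xi> where \<xi>: "\<xi> \<in> cball y \<delta>" "\<And>z. z \<in> cball y \<delta> \<Longrightarrow> \<Phi> z \<le> \<Phi> \<xi>"
    using continuous_attains_sup[OF compact_cball, of y \<delta> \<Phi>] \<delta>(1) by auto
  have ip: "(z - c) \<bullet> (z - c) = (dist c z)\<^sup>2" for z
    by (simp add: dist_norm dot_square_norm norm_minus_commute)
  have "\<Phi> y = m" using R y by (simp add: \<Phi>_def barrier_def ip)
  then have \<Phi>\<xi>: "\<Phi> \<xi> \<ge> m" using \<xi>(2)[of y] \<delta>(1) by simp
  have "\<xi> \<notin> sphere y \<delta>"
  proof
    assume s: "\<xi> \<in> sphere y \<delta>"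
    show False
    proof (cases "\<xi> \<in> cball c R")
      case True
      have "\<alpha> * (dist c \<xi>)\<^sup>2 \<ge> 0" using \<alpha>(1) by simp
      then have "?w \<xi> < 1"
        unfolding barrier_def ip by (smt (verit) exp_gt_zero exp_le_one_iff mult_minus_left)
      then have "\<eta> * ?w \<xi> < \<eta>" using \<eta>(1) by simp
      then show False using \<eta>(2)[of \<xi>] True s \<Phi>\<xi> by (simp add: P_def \<Phi>_def)
    next
      case False
      then have "R\<^sup>2 < (dist c \<xi>)\<^sup>2" using R(1) by (intro power_strict_mono) auto
      then have "?w \<xi> < 0" using \<alpha>(1) by (simp add: barrier_def ip)
      then have "\<eta> * ?w \<xi> < 0" using \<eta>(1) by (simp add: mult_pos_neg)
      then show False using max[of \<xi>] \<xi>(1) \<delta>(3) \<Phi>\<xi> by (auto simp: \<Phi>_def)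
    qed
  qed
  then have \<xi>b: "\<xi> \<in> ball y \<delta>" using \<xi>(1) by (simp add: less_le)
  have bU: "ball y \<delta> \<subseteq> U" using \<delta>(3) ball_subset_cball by blast
  have fd\<Phi>: "fd \<Phi> z = (\<lambda>h. fd u z h + \<eta> * fd ?w z h)" if "z \<in> U" for z
    unfolding \<Phi>_def by (intro fd_eqI has_derivative_add has_derivative_mult_right has_derivative_fd du dw that)
  have fd2: "((\<lambda>t. fd \<Phi> t v) has_derivative (\<lambda>h. fd (\<lambda>t. fd u t v) z h + \<eta> * fd (\<lambda>t. fd ?w t v) z h)) (at z)"
    if "z \<in> U" for z v
    by (rule has_derivative_cong_open[OF open_U that, of _ "\<lambda>t. fd u t v + \<eta> * fd ?w t v"])
       (auto simp: fd\<Phi> intro!: has_derivative_add has_derivative_mult_right has_derivative_fd du dw that)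
  have tw: "twice_differentiable_on (ball y \<delta>) \<Phi>"
    unfolding twice_differentiable_on_def
  proof (intro ballI conjI allI)
    fix z v assume "z \<in> ball y \<delta>"
    then have z: "z \<in> U" using bU by blast
    show "(\<lambda>t. fd \<Phi> t v) differentiable (at z)" using fd2[OF z] by (rule differentiableI)
    show "\<Phi> differentiable (at z)" unfolding \<Phi>_def by (intro derivative_intros du dw z)
  qed
  have \<xi>U: "\<xi> \<in> U" using bU \<xi>b by blast
  have "L \<Phi> \<xi> \<le> 0"
    by (rule L_nonpos_at_max[OF open_ball bU \<xi>b tw]) (use \<xi>(2) in auto)
  moreover have "L \<Phi> \<xi> = L u \<xi> + \<eta> * L ?w \<xi>"
    unfolding L_def fd_eqI[OF fd2[OF \<xi>U]] fd\<Phi>[OF \<xi>U]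
    by (simp add: algebra_simps sum_distrib_left sum.distrib)
  moreover have "\<eta> * L ?w \<xi> > 0" using \<alpha>(2)[OF \<xi>(1)] \<eta>(1) by simp
  ultimately show False using Lu[OF \<xi>U] by linarith
qed

text \<open>
  Near \<open>x0\<close>, grow a ball around a point where \<open>u\<close> is less than its maximum until it meets the set
  where the maximum is attained.  Half the radius towards a point of contact leaves a ball that
  touches this set in that point alone, which is excluded by \<open>no_touching_ball\<close>.
\<close>

theorem strong_maximum_principle:
  assumes u: "twice_differentiable_on U u" and Lu: "\<And>z. z \<in> U \<Longrightarrow> L u z \<ge> 0"
    and max: "\<And>z. z \<in> U \<Longrightarrow> u z \<le> m" and x0: "x0 \<in> U" "u x0 = m"
  shows "\<exists>r>0. ball x0 r \<subseteq> U \<and> (\<forall>z\<in>ball x0 r. u z = m)"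
proof -
  obtain r' where r': "r' > 0" "cball x0 r' \<subseteq> U"
    using open_U x0 open_contains_cball by blast
  define r where "r = r' / 2"
  have r: "r > 0" "cball x0 (2 * r) \<subseteq> U" using r' by (auto simp: r_def)
  have "u x1 = m" if x1: "x1 \<in> ball x0 r" for x1
  proof (rule ccontr)
    assume ne: "u x1 \<noteq> m"
    have cu: "continuous_on (cball x0 (2 * r)) u"
      using u r(2) differentiable_imp_continuous_within
      by (intro continuous_at_imp_continuous_on) (fastforce simp: twice_differentiable_on_def)
    define Z where "Z = {z \<in> cball x0 (2 * r). u z = m}"
    have "closed Z" unfolding Z_def
      using continuous_closed_preimage_constant[OF cu closed_cball] by simp
    moreover have x0Z: "x0 \<in> Z" using x0 r by (simp add: Z_def)
    ultimately obtain y where y: "y \<in> Z" "\<And>z. z \<in> Z \<Longrightarrow> dist x1 y \<le> dist x1 z"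
      using distance_attains_inf[of Z x1] by blast
    \<comment> \<open>The ball of half the radius through \<open>y\<close>, with centre halfway between \<open>x1\<close> and \<open>y\<close>.\<close>
    define c where "c = (1/2) *\<^sub>R (x1 + y)"
    define R where "R = dist x1 y / 2"
    have "x1 \<noteq> y" using y ne by (auto simp: Z_def)
    then have R: "R > 0" by (simp add: R_def)
    have cy: "y - c = (1/2) *\<^sub>R (y - x1)"
      by (simp add: c_def scaleR_right_diff_distrib scaleR_right_distrib) (simp add: algebra_simps flip: scaleR_left_distrib)
    have ncy: "norm (y - c) = R" unfolding cy R_def by (simp add: dist_norm norm_minus_commute)
    have xr: "dist x1 y < r" using y(2)[OF x0Z] x1 by (simp add: dist_commute)
    show False
    proof (rule no_touching_ball[OF u Lu max])
      show "y \<in> U" "u y = m" using y r by (auto simp: Z_def)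
      show "R > 0" by fact
      show "dist c y = R" using ncy by (simp add: dist_norm norm_minus_commute)
      fix z assume z: "z \<in> cball c R" "z \<noteq> y"
      define p where "p = z - c"
      define e where "e = y - c"
      have pe: "norm p \<le> R" "norm e = R" "p \<noteq> e" using z ncy by (auto simp: p_def e_def dist_norm norm_minus_commute)
      \<comment> \<open>The parallelogram law yields strict convexity: only \<open>p = e\<close> reaches distance \<open>2 * R\<close> from \<open>x1\<close>.\<close>
      have "(norm (p + e))\<^sup>2 + (norm (p - e))\<^sup>2 = 2 * (norm p)\<^sup>2 + 2 * (norm e)\<^sup>2"
        by (simp add: power2_norm_eq_inner algebra_simps inner_commute)
      moreover have "(norm (p - e))\<^sup>2 > 0" using pe(3) by simp
      moreover have "(norm p)\<^sup>2 \<le> R\<^sup>2" using pe(1) by (intro power_mono) auto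
      moreover have "(2 * R)\<^sup>2 = 4 * R\<^sup>2" by (simp add: power_mult_distrib)
      ultimately have "(norm (p + e))\<^sup>2 < (2 * R)\<^sup>2" unfolding pe(2) by linarith
      then have "norm (p + e) < 2 * R" by (rule power2_less_imp_less) (use R in simp)
      moreover have "p + e = z - x1"
      proof -
        have "c + c = x1 + y" by (simp add: c_def flip: scaleR_left_distrib)
        then show ?thesis by (simp add: p_def e_def algebra_simps)
      qed
      ultimately have dz: "dist x1 z < dist x1 y"
        by (simp add: R_def dist_norm norm_minus_commute)
      then have "z \<notin> Z" using y(2) by force
      moreover have zb: "z \<in> cball x0 (2 * r)"
        using dist_triangle[of x0 z x1] x1 dz xr by (simp add: dist_commute)
      ultimately have "u z \<noteq> m" by (simp add: Z_def)
      then show "u z < m" using max[of z] zb r by fastforce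
    qed
  qed
  moreover have "ball x0 r \<subseteq> U" using r by (auto intro!: subset_trans[OF _ r(2)])
  ultimately show ?thesis using r(1) by blast
qed

end

section \<open>The maximum principle for the warping function\<close>

context chart_metric begin

lemma inverse_metric_differentiable:
  assumes "x \<in> U"
  shows "(\<lambda>y. inverse_metric (G y) i j) differentiable (at x)"
proof -
  have "(\<lambda>y. sharp (G y) (\<lambda>w. w \<bullet> i)) differentiable (at x)"
    by (rule sharp_differentiable[OF open_U assms bilinear_G nondegenerate_G differentiable_G[OF assms]])
       (auto intro: linear_inner_right_arg)
  then show ?thesis
    unfolding inverse_metric_def by (intro differentiable_inner) auto
qed

text \<open>
  The inverse metric of \<open>v\<close> with itself is \<open>G s s\<close>, where \<open>s\<close> is \<open>v\<close> with its index raised.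
\<close>

lemma inverse_metric_pos:
  assumes x: "x \<in> U" and pos: "\<And>v. v \<noteq> 0 \<Longrightarrow> G x v v > 0" and v: "v \<noteq> 0"
  shows "(\<Sum>i\<in>Basis. \<Sum>j\<in>Basis. (v \<bullet> i) * (v \<bullet> j) * inverse_metric (G x) i j) > 0"
proof -
  let ?s = "sharp (G x) (\<lambda>w. w \<bullet> v)"
  have Gs: "G x ?s w = w \<bullet> v" for w by (rule G_sharp[OF x linear_inner_right_arg])
  have "?s \<noteq> 0"
    using Gs[of v] v bilinear_lzero[OF bilinear_G[OF x], of v] by auto
  then have "0 < ?s \<bullet> v" using pos[of ?s] Gs by simp
  also have "?s \<bullet> v = (\<Sum>i\<in>Basis. (v \<bullet> i) *\<^sub>R sharp (G x) (\<lambda>w. w \<bullet> i)) \<bullet> v"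
    by (subst sharp_expansion[OF bilinear_G[OF x] nondegenerate_G[OF x] linear_inner_right_arg])
       (simp add: inner_commute)
  also have "\<dots> = (\<Sum>i\<in>Basis. (v \<bullet> i) * (\<Sum>j\<in>Basis. (sharp (G x) (\<lambda>w. w \<bullet> i) \<bullet> j) * (v \<bullet> j)))"
    by (simp add: inner_sum_left) (simp add: euclidean_inner[of _ v])
  also have "\<dots> = (\<Sum>i\<in>Basis. \<Sum>j\<in>Basis. (v \<bullet> i) * (v \<bullet> j) * inverse_metric (G x) i j)"
    by (simp add: inverse_metric_def sum_distrib_left mult_ac)
  finally show ?thesis .
qed

end

text \<open>
  After multiplication by \<open>f / (2 * DIM('d))\<close> the inequality says that \<open>f\<close> is a subsolution of a
  linear elliptic operator.  The terms in \<open>|gradient f|\<^sup>2\<close> and \<open>\<langle>gradient f, gradient h\<rangle>\<close> are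
  linear in \<open>df\<close> once one of the two gradients is regarded as a given vector field.
\<close>

lemma (in warped_chart) warping_function_strong_maximum:
  assumes pos: "\<And>x v. x \<in> U \<Longrightarrow> v \<noteq> 0 \<Longrightarrow> G x v v > 0"
    and h: "twice_differentiable_on U h"
    and ineq: "\<And>x. x \<in> U \<Longrightarrow> 2 * DIM('d) * B.laplacian f x / f x
       + DIM('d) * (real DIM('d) - 1) * fd f x (N x) / (f x)\<^sup>2 + fd h x (N x) / f x \<ge> 0"
    and max: "\<And>x. x \<in> U \<Longrightarrow> f x \<le> m" and x0: "x0 \<in> U" "f x0 = m"
  shows "\<exists>r>0. ball x0 r \<subseteq> U \<and> (\<forall>z\<in>ball x0 r. f z = m)"
proof -
  define d where "d = real DIM('d)"
  have d: "d > 0" by (simp add: d_def)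
  \<comment> \<open>The drift collects the two gradient fields and the Christoffel terms of the Laplacian.\<close>
  define b where "b x = ((d - 1) / (2 * f x)) *\<^sub>R N x + (1 / (2 * d)) *\<^sub>R B.gradient h x
    - (\<Sum>i\<in>Basis. \<Sum>j\<in>Basis. inverse_metric (G x) i j *\<^sub>R christoffel G x i j)" for x
  have hd: "h differentiable (at x)" if "x \<in> U" for x using h that by (simp add: twice_differentiable_on_def)
  have cont: "continuous_on U g" if "\<And>x. x \<in> U \<Longrightarrow> g differentiable (at x)" for g :: "'e \<Rightarrow> 'z::real_normed_vector"
    using that differentiable_imp_continuous_within by (intro continuous_at_imp_continuous_on) blast
  interpret L: elliptic_operator U "\<lambda>x. inverse_metric (G x)" b
  proof
    show "open U" by (rule B.open_U)
    show "inverse_metric (G x) i j = inverse_metric (G x) j i" if "x \<in> U" for x i j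
      using inverse_metric_sym[OF B.bilinear_G B.nondegenerate_G B.sym_G] that by blast
    show "(\<Sum>i\<in>Basis. \<Sum>j\<in>Basis. (v \<bullet> i) * (v \<bullet> j) * inverse_metric (G x) i j) > 0"
      if "x \<in> U" "v \<noteq> 0" for x v
      using B.inverse_metric_pos[OF that(1) pos[OF that(1)] that(2)] .
    show "continuous_on U (\<lambda>x. inverse_metric (G x) i j)" for i j
      by (rule cont[OF B.inverse_metric_differentiable])
    have ch: "continuous_on U (B.gradient h)"
      using cont[OF B.gradient_differentiable[OF h]] by (simp add: B.gradient_def[abs_def])
    show "continuous_on U b"
      unfolding b_def
      by (intro continuous_intros cont[OF differentiable_N] ch cont[OF differentiable_f]
          cont[OF B.inverse_metric_differentiable] cont[OF B.christoffel_differentiable])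
         (auto dest: f_pos)
  qed
  show ?thesis
  proof (rule L.strong_maximum_principle[OF twice_differentiable_f _ max x0])
    fix x assume x: "x \<in> U"
    have "fd h x (N x) = G x (B.gradient h x) (N x)" by (simp add: B.G_gradient[OF x hd[OF x]])
    also have "\<dots> = fd f x (B.gradient h x)"
      using B.G_gradient[OF x differentiable_f[OF x]] B.sym_G[OF x] by metis
    finally have hN: "fd h x (N x) = fd f x (B.gradient h x)" .
    note lin = linear_fd_f[OF x]
    have "L.L f x = B.laplacian f x + (d - 1) / (2 * f x) * fd f x (N x) + 1 / (2 * d) * fd h x (N x)"
      unfolding L.L_def B.laplacian_def hess_def b_def hN
      by (simp add: linear_add[OF lin] linear_diff[OF lin] linear_cmul[OF lin] linear_sum[OF lin]
          right_diff_distrib sum_subtractf)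
    also have "\<dots> = f x / (2 * d) * (2 * d * B.laplacian f x / f x
       + d * (d - 1) * fd f x (N x) / (f x)\<^sup>2 + fd h x (N x) / f x)"
      using d f_pos[OF x] by (simp add: divide_simps) (simp add: algebra_simps power2_eq_square)
    also have "\<dots> \<ge> 0"
      using ineq[OF x] d f_pos[OF x] by (intro mult_nonneg_nonneg) (simp_all add: d_def)
    finally show "0 \<le> L.L f x" .
  qed
qed

section \<open>Product charts\<close>

lemma christoffel_cong_open:
  assumes S: "open S" "x \<in> S" and eq: "\<And>y. y \<in> S \<Longrightarrow> G y = G' y"
  shows "christoffel G x = christoffel G' x"
proof -
  have "fd (\<lambda>y. G y v w) x = fd (\<lambda>y. G' y v w) x" for v w
    by (rule fd_cong_open[OF S]) (simp add: eq)
  then show ?thesis using eq[OF S(2)] by (intro ext) (simp add: christoffel_def)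
qed

lemma scalar_curv_cong_open:
  assumes S: "open S" "x \<in> S" and eq: "\<And>y. y \<in> S \<Longrightarrow> G y = G' y"
  shows "scalar_curv G x = scalar_curv G' x"
proof -
  have c: "christoffel G y = christoffel G' y" if "y \<in> S" for y
    by (rule christoffel_cong_open[OF S(1) that eq])
  have "fd (\<lambda>y. christoffel G y v w) x = fd (\<lambda>y. christoffel G' y v w) x" for v w
    by (rule fd_cong_open[OF S]) (simp add: c)
  then have "riemann G x = riemann G' x"
    using c[OF S(2)] by (intro ext) (simp add: riemann_def)
  then show ?thesis using eq[OF S(2)] by (simp add: scalar_curv_def ricci_def)
qed

lemma hess_cong_open:
  assumes S: "open S" "x \<in> S" and eq: "\<And>y. y \<in> S \<Longrightarrow> G y = G' y" and u: "\<And>y. y \<in> S \<Longrightarrow> u y = u' y"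
  shows "hess G u x = hess G' u' x"
proof -
  have f: "fd u y = fd u' y" if "y \<in> S" for y
    by (rule fd_cong_open[OF S(1) that u])
  have "fd (\<lambda>y. fd u y w) x = fd (\<lambda>y. fd u' y w) x" for w
    by (rule fd_cong_open[OF S]) (simp add: f)
  then show ?thesis
    using christoffel_cong_open[OF S eq] f[OF S(2)] by (intro ext) (simp add: hess_def)
qed

text \<open>
  The composition of a function with the inverse of a chart is arbitrary outside the image of the
  chart, so that formulas for it hold on open sets only.
\<close>

lemma Ck_on_cong_open:
  assumes "open S" "\<And>x. x \<in> S \<Longrightarrow> f x = g x" "Ck_on k S f"
  shows "Ck_on k S g"
  using assms(2,3)
proof (induction k arbitrary: f g)
  case 0
  then show ?case by (simp cong: continuous_on_cong)
next
  case (Suc k)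
  have "g differentiable (at x)" if "x \<in> S" for x
    using Suc.prems that by (intro differentiable_cong_open[OF \<open>open S\<close> that, of g f]) auto
  moreover have "Ck_on k S (\<lambda>x. fd g x v)" for v
  proof (rule Suc.IH[of "\<lambda>x. fd f x v"])
    show "fd f x v = fd g x v" if "x \<in> S" for x
      using fd_cong_open[OF \<open>open S\<close> that, of f g] Suc.prems(1) by simp
  qed (use Suc.prems(2) in simp)
  ultimately show ?case by simp
qed

lemma Ck_on_compose_fst:
  assumes "open S" "open T" "Ck_on k S f"
  shows "Ck_on k (S \<times> T) (\<lambda>p. f (fst p))"
  using assms(3)
proof (induction k arbitrary: f)
  case 0
  then show ?case by (auto intro!: continuous_on_compose2[of S f _ fst] continuous_intros)
next
  case (Suc k)
  note d = has_derivative_compose_fst[of f]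
  have "(\<lambda>p. f (fst p)) differentiable (at p)" if "p \<in> S \<times> T" for p
    using d[of p] Suc.prems that by (auto intro: differentiableI)
  moreover have "Ck_on k (S \<times> T) (\<lambda>p. fd (\<lambda>q. f (fst q)) p v)" for v
  proof (rule Ck_on_cong_open[of _ "\<lambda>p. fd f (fst p) (fst v)"])
    show "Ck_on k (S \<times> T) (\<lambda>p. fd f (fst p) (fst v))"
      using Suc.prems by (intro Suc.IH) simp
    show "fd f (fst p) (fst v) = fd (\<lambda>q. f (fst q)) p v" if "p \<in> S \<times> T" for p
      using fd_eqI[OF d[of p]] Suc.prems that by auto
  qed (use assms in \<open>auto intro: open_Times\<close>)
  ultimately show ?case by simp
qed

lemma Ck_on_compose_snd:
  assumes "open S" "open T" "Ck_on k T f"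
  shows "Ck_on k (S \<times> T) (\<lambda>p. f (snd p))"
  using assms(3)
proof (induction k arbitrary: f)
  case 0
  then show ?case by (auto intro!: continuous_on_compose2[of T f _ snd] continuous_intros)
next
  case (Suc k)
  note d = has_derivative_compose_snd[of f]
  have "(\<lambda>p. f (snd p)) differentiable (at p)" if "p \<in> S \<times> T" for p
    using d[of p] Suc.prems that by (auto intro: differentiableI)
  moreover have "Ck_on k (S \<times> T) (\<lambda>p. fd (\<lambda>q. f (snd q)) p v)" for v
  proof (rule Ck_on_cong_open[of _ "\<lambda>p. fd f (snd p) (snd v)"])
    show "Ck_on k (S \<times> T) (\<lambda>p. fd f (snd p) (snd v))"
      using Suc.prems by (intro Suc.IH) simp
    show "fd f (snd p) (snd v) = fd (\<lambda>q. f (snd q)) p v" if "p \<in> S \<times> T" for p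
      using fd_eqI[OF d[of p]] Suc.prems that by auto
  qed (use assms in \<open>auto intro: open_Times\<close>)
  ultimately show ?case by simp
qed

lemma chart_inv_in_dom: "x \<in> chart_img c \<Longrightarrow> chart_inv c x \<in> chart_dom c"
  and chart_map_inv: "x \<in> chart_img c \<Longrightarrow> chart_map c (chart_inv c x) = x"
  by (simp_all add: chart_img_def chart_inv_def inv_into_into f_inv_into_f)

lemma chart_map_in_img: "p \<in> chart_dom c \<Longrightarrow> chart_map c p \<in> chart_img c"
  by (simp add: chart_img_def)

lemma
  assumes "smooth_atlas A" "c \<in> A"
  shows open_chart_dom: "open (chart_dom c)" and open_chart_img: "open (chart_img c)"
    and chart_homeomorphism: "homeomorphism (chart_dom c) (chart_img c) (chart_map c) (chart_inv c)"
  using assms by (auto simp: smooth_atlas_def)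

lemma chart_inv_map:
  "smooth_atlas A \<Longrightarrow> c \<in> A \<Longrightarrow> p \<in> chart_dom c \<Longrightarrow> chart_inv c (chart_map c p) = p"
  using chart_homeomorphism homeomorphism_apply1 by blast

lemma chart_cover: "smooth_atlas A \<Longrightarrow> \<exists>c\<in>A. p \<in> chart_dom c"
  unfolding smooth_atlas_def by blast

lemma open_chart_map_image:
  assumes "smooth_atlas A" "c \<in> A" "open W"
  shows "open (chart_map c ` (W \<inter> chart_dom c))"
proof -
  have "openin (top_of_set (chart_dom c)) (W \<inter> chart_dom c)"
    unfolding Int_commute[of W] by (rule openin_open_Int[OF assms(3)])
  then show ?thesis
    using homeomorphism_imp_open_map[OF chart_homeomorphism[OF assms(1,2)]]
      open_chart_img[OF assms(1,2)] openin_open_trans by blast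
qed

lemma smooth_fun_chart:
  "smooth_fun A k \<Longrightarrow> c \<in> A \<Longrightarrow> smooth_on (chart_img c) (k \<circ> chart_inv c)"
  by (auto simp: smooth_fun_on_def chart_img_def)

lemma smooth_near_differentiable:
  assumes A: "smooth_atlas A" "c \<in> A" and x: "x \<in> chart_img c"
    and k: "smooth_near A (chart_inv c x) k"
  shows "(k \<circ> chart_inv c) differentiable (at x)"
proof -
  obtain W where W: "chart_inv c x \<in> W" "smooth_fun_on A W k"
    using k by (auto simp: smooth_near_def)
  have "x \<in> chart_map c ` (W \<inter> chart_dom c)"
    using chart_inv_in_dom[OF x] chart_map_inv[OF x] W(1) by force
  moreover have "smooth_on (chart_map c ` (W \<inter> chart_dom c)) (k \<circ> chart_inv c)"
    using W(2) A(2) by (simp add: smooth_fun_on_def)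
  ultimately show ?thesis
    using smooth_on_twice_differentiable by (auto simp: twice_differentiable_on_def)
qed

lemma semi_riemannian_chart_metric:
  assumes "smooth_atlas A" "semi_riemannian_metric A g" "c \<in> A"
  shows "chart_metric (chart_img c) (coord_form A c g)"
proof
  show "open (chart_img c)" by (rule open_chart_img[OF assms(1,3)])
  show "twice_differentiable_on (chart_img c) (\<lambda>x. coord_form A c g x v w)" for v w
    using assms(2,3) by (intro smooth_on_twice_differentiable) (simp add: semi_riemannian_metric_def)
qed (use assms(2,3) in \<open>auto simp: semi_riemannian_metric_def\<close>)

lemma chart_dom_product: "chart_dom (product_chart c c') = chart_dom c \<times> chart_dom c'"
  and chart_map_product: "chart_map (product_chart c c') p = (chart_map c (fst p), chart_map c' (snd p))"
  by (simp_all add: chart_dom_def chart_map_def product_chart_def map_prod_def split: prod.splits)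

locale two_atlases =
  fixes A\<^sub>B :: "('b::topological_space, 'e::euclidean_space) chart set"
    and A\<^sub>F :: "('f::topological_space, 'd::euclidean_space) chart set"
  assumes atlas_B: "smooth_atlas A\<^sub>B" and atlas_F: "smooth_atlas A\<^sub>F"
begin

abbreviation "P \<equiv> product_atlas A\<^sub>B A\<^sub>F"

lemma chart_inv_product:
  assumes c: "c \<in> A\<^sub>B" "c' \<in> A\<^sub>F" and x: "x \<in> chart_img c" "y \<in> chart_img c'"
  shows "chart_inv (product_chart c c') (x, y) = (chart_inv c x, chart_inv c' y)"
  unfolding chart_inv_def[of "product_chart c c'"]
proof (rule inv_into_f_eq)
  show "inj_on (chart_map (product_chart c c')) (chart_dom (product_chart c c'))"
    using chart_inv_map[OF atlas_B c(1)] chart_inv_map[OF atlas_F c(2)]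
    by (intro inj_onI) (auto simp: chart_dom_product chart_map_product; metis)
qed (use x in \<open>simp_all add: chart_dom_product chart_map_product chart_inv_in_dom chart_map_inv\<close>)

text \<open>
  The pushforward of a tangent vector evaluates it on \<open>k \<circ> fst\<close>, and by convention a coordinate
  vector is zero on functions that are not smooth near the base point.  Hence smoothness has to be
  carried over to the product for the derivative of \<open>k\<close> to survive.
\<close>

lemma smooth_near_compose_fst:
  assumes "smooth_near A\<^sub>B (fst p) k"
  shows "smooth_near P p (k \<circ> fst)"
proof -
  obtain W where W: "open W" "fst p \<in> W" "smooth_fun_on A\<^sub>B W k"
    using assms by (auto simp: smooth_near_def)
  have "smooth_fun_on P (W \<times> UNIV) (k \<circ> fst)"
    unfolding smooth_fun_on_def
  proof
    fix q assume "q \<in> P"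
    then obtain c c' where q: "q = product_chart c c'" and c: "c \<in> A\<^sub>B" "c' \<in> A\<^sub>F"
      by (auto simp: product_atlas_def)
    let ?S = "chart_map c ` (W \<inter> chart_dom c)" and ?T = "chart_img c'"
    have open_ST: "open ?S" "open ?T"
      using open_chart_map_image[OF atlas_B c(1) W(1)] open_chart_img[OF atlas_F c(2)] by auto
    have img_dom: "W \<times> UNIV \<inter> chart_dom q = (W \<inter> chart_dom c) \<times> chart_dom c'"
      by (auto simp: q chart_dom_product)
    have chart_map_prod: "chart_map q = map_prod (chart_map c) (chart_map c')"
      by (auto simp: q chart_map_product)
    have img: "chart_map q ` (W \<times> UNIV \<inter> chart_dom q) = ?S \<times> ?T"
      unfolding img_dom chart_map_prod by (rule map_prod_surj_on) (simp_all add: chart_img_def)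
    have "Ck_on n ?S (k \<circ> chart_inv c)" for n
      using W(3) c(1) by (simp add: smooth_fun_on_def smooth_on_def)
    then have smooth: "Ck_on n (?S \<times> ?T) (\<lambda>z. (k \<circ> chart_inv c) (fst z))" for n
      by (rule Ck_on_compose_fst[OF open_ST])
    have eq: "(k \<circ> chart_inv c) (fst z) = (k \<circ> fst \<circ> chart_inv q) z" if "z \<in> ?S \<times> ?T" for z
      using that chart_inv_product[OF c, of "fst z" "snd z"] by (auto simp: q chart_img_def)
    show "smooth_on (chart_map q ` (W \<times> UNIV \<inter> chart_dom q)) (k \<circ> fst \<circ> chart_inv q)"
      unfolding smooth_on_def img by (intro allI Ck_on_cong_open[OF open_Times[OF open_ST] eq smooth])
  qed
  then show ?thesis
    unfolding smooth_near_def using W(1,2)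
    by (intro exI[of _ "W \<times> UNIV"]) (auto intro: open_Times simp: mem_Times_iff)
qed

lemma smooth_near_compose_snd:
  assumes "smooth_near A\<^sub>F (snd p) k"
  shows "smooth_near P p (k \<circ> snd)"
proof -
  obtain W where W: "open W" "snd p \<in> W" "smooth_fun_on A\<^sub>F W k"
    using assms by (auto simp: smooth_near_def)
  have "smooth_fun_on P (UNIV \<times> W) (k \<circ> snd)"
    unfolding smooth_fun_on_def
  proof
    fix q assume "q \<in> P"
    then obtain c c' where q: "q = product_chart c c'" and c: "c \<in> A\<^sub>B" "c' \<in> A\<^sub>F"
      by (auto simp: product_atlas_def)
    let ?S = "chart_img c" and ?T = "chart_map c' ` (W \<inter> chart_dom c')"
    have open_ST: "open ?S" "open ?T"
      using open_chart_map_image[OF atlas_F c(2) W(1)] open_chart_img[OF atlas_B c(1)] by auto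
    have img_dom: "UNIV \<times> W \<inter> chart_dom q = chart_dom c \<times> (W \<inter> chart_dom c')"
      by (auto simp: q chart_dom_product)
    have chart_map_prod: "chart_map q = map_prod (chart_map c) (chart_map c')"
      by (auto simp: q chart_map_product)
    have img: "chart_map q ` (UNIV \<times> W \<inter> chart_dom q) = ?S \<times> ?T"
      unfolding img_dom chart_map_prod by (rule map_prod_surj_on) (simp_all add: chart_img_def)
    have "Ck_on n ?T (k \<circ> chart_inv c')" for n
      using W(3) c(2) by (simp add: smooth_fun_on_def smooth_on_def)
    then have smooth: "Ck_on n (?S \<times> ?T) (\<lambda>z. (k \<circ> chart_inv c') (snd z))" for n
      by (rule Ck_on_compose_snd[OF open_ST])
    have eq: "(k \<circ> chart_inv c') (snd z) = (k \<circ> snd \<circ> chart_inv q) z" if "z \<in> ?S \<times> ?T" for z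
      using that chart_inv_product[OF c, of "fst z" "snd z"] by (auto simp: q chart_img_def)
    show "smooth_on (chart_map q ` (UNIV \<times> W \<inter> chart_dom q)) (k \<circ> snd \<circ> chart_inv q)"
      unfolding smooth_on_def img by (intro allI Ck_on_cong_open[OF open_Times[OF open_ST] eq smooth])
  qed
  then show ?thesis
    unfolding smooth_near_def using W(1,2)
    by (intro exI[of _ "UNIV \<times> W"]) (auto intro: open_Times simp: mem_Times_iff)
qed

lemma coord_vector_product:
  assumes c: "c \<in> A\<^sub>B" "c' \<in> A\<^sub>F" and x: "x \<in> chart_img c" "y \<in> chart_img c'"
  shows "pushforward A\<^sub>B fst (chart_inv c x, chart_inv c' y)
      (coord_vector P (product_chart c c') (chart_inv c x, chart_inv c' y) v)
      = coord_vector A\<^sub>B c (chart_inv c x) (fst v)" (is ?B)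
    and "pushforward A\<^sub>F snd (chart_inv c x, chart_inv c' y)
      (coord_vector P (product_chart c c') (chart_inv c x, chart_inv c' y) v)
      = coord_vector A\<^sub>F c' (chart_inv c' y) (snd v)" (is ?F)
proof -
  let ?p = "(chart_inv c x, chart_inv c' y)" and ?q = "product_chart c c'"
  have q: "chart_map ?q ?p = (x, y)" using x by (simp add: chart_map_product chart_map_inv)
  have "open (chart_img c \<times> chart_img c')"
    using open_chart_img[OF atlas_B c(1)] open_chart_img[OF atlas_F c(2)] by (rule open_Times)
  note cong = fd_cong_open[OF this, of "(x, y)"]
  have "fd (k \<circ> fst \<circ> chart_inv ?q) (x, y) v = fd (k \<circ> chart_inv c) x (fst v)"
    if k: "smooth_near A\<^sub>B (chart_inv c x) k" for k
  proof -
    have "fd (k \<circ> fst \<circ> chart_inv ?q) (x, y) = fd (\<lambda>z. (k \<circ> chart_inv c) (fst z)) (x, y)"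
      by (rule cong) (use x chart_inv_product[OF c] in auto)
    then show ?thesis
      using fd_eqI[OF has_derivative_compose_fst[of "k \<circ> chart_inv c" "(x, y)"]]
        smooth_near_differentiable[OF atlas_B c(1) x(1) k] by simp
  qed
  then show ?B
    unfolding pushforward_def coord_vector_def
    using smooth_near_compose_fst[of ?p] x by (intro ext) (simp add: q chart_map_inv)
  have "fd (k \<circ> snd \<circ> chart_inv ?q) (x, y) v = fd (k \<circ> chart_inv c') y (snd v)"
    if k: "smooth_near A\<^sub>F (chart_inv c' y) k" for k
  proof -
    have "fd (k \<circ> snd \<circ> chart_inv ?q) (x, y) = fd (\<lambda>z. (k \<circ> chart_inv c') (snd z)) (x, y)"
      by (rule cong) (use x chart_inv_product[OF c] in auto)
    then show ?thesis
      using fd_eqI[OF has_derivative_compose_snd[of "k \<circ> chart_inv c'" "(x, y)"]]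
        smooth_near_differentiable[OF atlas_F c(2) x(2) k] by simp
  qed
  then show ?F
    unfolding pushforward_def coord_vector_def
    using smooth_near_compose_snd[of ?p] x by (intro ext) (simp add: q chart_map_inv)
qed

lemma coord_form_warped_metric:
  assumes "c \<in> A\<^sub>B" "c' \<in> A\<^sub>F" "p \<in> chart_img c \<times> chart_img c'"
  shows "coord_form P (product_chart c c') (warped_metric A\<^sub>B A\<^sub>F g\<^sub>B f g\<^sub>F) p =
    warped_form (coord_form A\<^sub>B c g\<^sub>B) (f \<circ> chart_inv c) (coord_form A\<^sub>F c' g\<^sub>F) p"
  using assms
  by (cases p) (auto simp: coord_form_def warped_metric_def pullback_def warped_form_def chart_inv_product
      coord_vector_product intro!: ext)

end

section \<open>Gradient Yamabe solitons on warped products\<close>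

text \<open>
  The fundamental equation.  On vertical vectors the Hessian of \<open>h\<close> is
  \<open>f dh(gradient f) g\<^sub>F\<close> while the metric is \<open>f\<^sup>2 g\<^sub>F\<close>, so the soliton equation says
  \<open>S - \<rho> = dh(gradient f) / f\<close>; inserting the scalar curvature of the warped product gives the claim.
\<close>

lemma warped_soliton_identity:
  fixes A\<^sub>B :: "('b::{t2_space,second_countable_topology}, 'e::euclidean_space) chart set"
    and A\<^sub>F :: "('f::{t2_space,second_countable_topology}, 'd::euclidean_space) chart set"
    and h :: "'b \<Rightarrow> real"
  assumes atlases: "smooth_atlas A\<^sub>B" "smooth_atlas A\<^sub>F"
    and c: "c \<in> A\<^sub>B" "c' \<in> A\<^sub>F" and xy: "x \<in> chart_img c" "y \<in> chart_img c'"
    and W: "warped_chart (chart_img c) (coord_form A\<^sub>B c g\<^sub>B) (chart_img c') (coord_form A\<^sub>F c' g\<^sub>F) (f \<circ> chart_inv c)"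
    and SB: "has_scalar_curvature A\<^sub>B g\<^sub>B S\<^sub>B" and SF: "has_scalar_curvature A\<^sub>F g\<^sub>F (\<lambda>_. lam\<^sub>F)"
    and h: "smooth_fun A\<^sub>B h"
    and soliton: "gradient_yamabe_soliton (product_atlas A\<^sub>B A\<^sub>F) (warped_metric A\<^sub>B A\<^sub>F g\<^sub>B f g\<^sub>F) (h \<circ> fst) \<rho>"
  defines "G \<equiv> coord_form A\<^sub>B c g\<^sub>B" and "F \<equiv> f \<circ> chart_inv c" and "H \<equiv> h \<circ> chart_inv c"
    and "d \<equiv> real DIM('d)"
  shows "2 * d * chart_metric.laplacian G F x / F x
      + d * (d - 1) * fd F x (chart_metric.gradient G F x) / (F x)\<^sup>2
      + fd H x (chart_metric.gradient G F x) / F x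
    = S\<^sub>B (chart_inv c x) + lam\<^sub>F / (F x)\<^sup>2 - \<rho>"
proof -
  interpret two_atlases A\<^sub>B A\<^sub>F by unfold_locales fact+
  define K where "K = coord_form A\<^sub>F c' g\<^sub>F"
  interpret warped_chart "chart_img c" G "chart_img c'" K F
    using W by (simp add: G_def F_def K_def)
  let ?g = "warped_metric A\<^sub>B A\<^sub>F g\<^sub>B f g\<^sub>F" and ?q = "product_chart c c'"
  let ?p = "(chart_inv c x, chart_inv c' y)" and ?UV = "chart_img c \<times> chart_img c'"
  obtain S where S: "has_scalar_curvature P ?g S"
    and hS: "has_hessian P ?g (h \<circ> fst) (\<lambda>p X Y. (S p - \<rho>) * ?g p X Y)"
    using soliton by (auto simp: gradient_yamabe_soliton_def)
  have q: "?q \<in> P"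
    unfolding product_atlas_def using c by blast
  have q: "?q \<in> P" "?p \<in> chart_dom ?q" "chart_map ?q ?p = (x, y)" "chart_inv ?q (x, y) = ?p" "(x, y) \<in> ?UV"
    using q c xy by (auto simp: chart_dom_product chart_map_product chart_inv_in_dom
        chart_map_inv chart_inv_product)
  have form: "coord_form P ?q ?g z = W z" if "z \<in> ?UV" for z
    using coord_form_warped_metric[OF c that] by (simp add: G_def F_def K_def)
  have hdiff: "H differentiable (at t)" if "t \<in> chart_img c" for t
    using smooth_on_twice_differentiable[OF smooth_fun_chart[OF h c(1)]] that
    by (simp add: H_def twice_differentiable_on_def)
  have "S ?p = scalar_curv (coord_form P ?q ?g) (x, y)"
    using S q by (simp add: has_scalar_curvature_def)
  also have "\<dots> = scalar_curv W (x, y)"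
    by (rule scalar_curv_cong_open[OF open_UV q(5) form])
  finally have Sp: "S ?p = scalar_curv W (x, y)" .
  have "S\<^sub>B (chart_inv c x) = scalar_curv G (chart_map c (chart_inv c x))"
    using SB c(1) chart_inv_in_dom[OF xy(1)] unfolding has_scalar_curvature_def G_def by blast
  then have SB_x: "scalar_curv G x = S\<^sub>B (chart_inv c x)" by (simp add: chart_map_inv[OF xy(1)])
  have "lam\<^sub>F = scalar_curv K (chart_map c' (chart_inv c' y))"
    using SF c(2) chart_inv_in_dom[OF xy(2)] unfolding has_scalar_curvature_def K_def by blast
  then have SF_y: "scalar_curv K y = lam\<^sub>F" by (simp add: chart_map_inv[OF xy(2)])
  have scal: "S ?p = S\<^sub>B (chart_inv c x) + lam\<^sub>F / (F x)\<^sup>2 - 2 * d * B.laplacian F x / F x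
      - d * (d - 1) * fd F x (N x) / (F x)\<^sup>2"
    using scalar_curv_W[OF xy] by (simp add: Sp SB_x SF_y d_def)
  have hess_eq: "(S ?p - \<rho>) * W (x, y) v w = hess W (\<lambda>z. H (fst z)) (x, y) v w" for v w
  proof -
    have "(S ?p - \<rho>) * ?g ?p (coord_vector P ?q ?p v) (coord_vector P ?q ?p w) =
        hess (coord_form P ?q ?g) (h \<circ> fst \<circ> chart_inv ?q) (chart_map ?q ?p) v w"
      using hS q(1,2) unfolding has_hessian_def by blast
    moreover have "hess (coord_form P ?q ?g) (h \<circ> fst \<circ> chart_inv ?q) (x, y) = hess W (\<lambda>z. H (fst z)) (x, y)"
      by (rule hess_cong_open[OF open_UV q(5) form]) (auto simp: H_def chart_inv_product[OF c])
    moreover note q(3)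
    moreover have "?g ?p (coord_vector P ?q ?p v) (coord_vector P ?q ?p w) = W (x, y) v w"
      by (simp add: form[OF q(5), symmetric] coord_form_def q(4))
    ultimately show ?thesis by simp
  qed
  \<comment> \<open>The fibre has positive dimension and a nondegenerate metric.\<close>
  obtain v w where vw: "K y v w \<noteq> 0"
    using F.nondegenerate_G[OF xy(2)] nonempty_Basis nonzero_Basis unfolding nondegenerate_def by blast
  have "(S ?p - \<rho>) * ((F x)\<^sup>2 * K y v w) = F x * fd H x (N x) * K y v w"
    using hess_eq[of "(0, v)" "(0, w)"] hess_W_vertical[OF xy hdiff]
    by (simp add: warped_form_def bilinear_lzero[OF B.bilinear_G[OF xy(1)]])
  then have "(F x * K y v w) * ((S ?p - \<rho>) * F x) = (F x * K y v w) * fd H x (N x)"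
    by (simp add: power2_eq_square mult_ac)
  then have "(S ?p - \<rho>) * F x = fd H x (N x)"
    using vw f_pos[OF xy(1)] by (simp only: mult_cancel_left) simp
  then have "S ?p - \<rho> = fd H x (N x) / F x"
    using f_pos[OF xy(1)] by (simp add: field_simps)
  then show ?thesis using scal by simp
qed

lemma smooth_fun_continuous:
  fixes A :: "('m::t2_space, 'e::euclidean_space) chart set"
  assumes A: "smooth_atlas A" and k: "smooth_fun A k"
  shows "continuous_on UNIV k"
proof -
  have "isCont k p" for p
  proof -
    obtain c where c: "c \<in> A" "p \<in> chart_dom c" using chart_cover[OF A] by blast
    have "Ck_on 0 (chart_img c) (k \<circ> chart_inv c)"
      using smooth_fun_chart[OF k c(1)] unfolding smooth_on_def by blast
    then have "continuous_on (chart_img c) (k \<circ> chart_inv c)" by simp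
    then have "continuous_on (chart_dom c) ((k \<circ> chart_inv c) \<circ> chart_map c)"
      unfolding chart_img_def
      by (rule continuous_on_compose[OF homeomorphism_cont1[OF chart_homeomorphism[OF A c(1)]]])
    then have "continuous_on (chart_dom c) k"
      by (rule continuous_on_eq) (simp add: chart_inv_map[OF A c(1)])
    then show ?thesis
      using continuous_on_eq_continuous_at[OF open_chart_dom[OF A c(1)]] c(2) by blast
  qed
  then show ?thesis by (simp add: continuous_at_imp_continuous_on)
qed

text \<open>
  The set \<open>M\<close> where \<open>f\<close> attains its maximum is closed by continuity.  It is open by the strong
  maximum principle in a chart around each of its points; any one chart of the fibre serves for
  all of them.
\<close>

theorem theorem1p4:
  fixes A\<^sub>B :: "('b::{t2_space,second_countable_topology}, 'e::euclidean_space) chart set"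
    and A\<^sub>F :: "('f::{t2_space,second_countable_topology}, 'd::euclidean_space) chart set"
    and g\<^sub>B :: "'b tensor2" and g\<^sub>F :: "'f tensor2"
    and f h S\<^sub>B :: "'b \<Rightarrow> real" and lam\<^sub>F \<rho> :: real
  assumes "riemannian_manifold A\<^sub>B g\<^sub>B"
    and "has_scalar_curvature A\<^sub>B g\<^sub>B S\<^sub>B"
    and "semi_riemannian_manifold A\<^sub>F g\<^sub>F"
    and "has_scalar_curvature A\<^sub>F g\<^sub>F (\<lambda>_. lam\<^sub>F)"
    and "smooth_fun A\<^sub>B f" and "\<And>p. f p > 0"
    and "smooth_fun A\<^sub>B h"
    and "gradient_yamabe_soliton (product_atlas A\<^sub>B A\<^sub>F) (warped_metric A\<^sub>B A\<^sub>F g\<^sub>B f g\<^sub>F) (h \<circ> fst) \<rho>"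
    and "\<And>p. S\<^sub>B p \<ge> \<rho> - lam\<^sub>F / (f p)\<^sup>2"
    and "\<exists>p\<^sub>0. \<forall>p. f p \<le> f p\<^sub>0"
  shows "f constant_on UNIV"
proof -
  have B: "smooth_atlas A\<^sub>B" "semi_riemannian_metric A\<^sub>B g\<^sub>B" "connected (UNIV :: 'b set)"
    and pos: "\<And>c x v. c \<in> A\<^sub>B \<Longrightarrow> x \<in> chart_img c \<Longrightarrow> v \<noteq> 0 \<Longrightarrow> coord_form A\<^sub>B c g\<^sub>B x v v > 0"
    using assms(1) by (auto simp: riemannian_manifold_def semi_riemannian_manifold_def smooth_manifold_def)
  have F: "smooth_atlas A\<^sub>F" "semi_riemannian_metric A\<^sub>F g\<^sub>F"
    using assms(3) by (auto simp: semi_riemannian_manifold_def smooth_manifold_def)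
  obtain p\<^sub>0 where p0: "\<And>p. f p \<le> f p\<^sub>0" using assms(10) by blast
  define M where "M = {p. f p = f p\<^sub>0}"
  \<comment> \<open>Types being nonempty, the fibre has a point.\<close>
  obtain c' where c': "c' \<in> A\<^sub>F" "undefined \<in> chart_dom c'" using chart_cover[OF F(1)] by blast
  define y where "y = chart_map c' undefined"
  have y: "y \<in> chart_img c'" unfolding y_def using c'(2) by (rule chart_map_in_img)
  have "closed M"
    unfolding M_def using smooth_fun_continuous[OF B(1) assms(5)]
    by (intro closed_Collect_eq) (auto intro: continuous_intros)
  moreover have "open M"
    unfolding open_subopen[of M]
  proof
    fix p assume "p \<in> M"
    obtain c where c: "c \<in> A\<^sub>B" "p \<in> chart_dom c" using chart_cover[OF B(1)] by blast
    define x where "x = chart_map c p"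
    have x: "x \<in> chart_img c" "chart_inv c x = p"
      unfolding x_def using chart_map_in_img[OF c(2)] chart_inv_map[OF B(1) c] by simp_all
    interpret warped_chart "chart_img c" "coord_form A\<^sub>B c g\<^sub>B" "chart_img c'" "coord_form A\<^sub>F c' g\<^sub>F" "f \<circ> chart_inv c"
      using semi_riemannian_chart_metric[OF B(1,2) c(1)] semi_riemannian_chart_metric[OF F c'(1)]
        smooth_on_twice_differentiable[OF smooth_fun_chart[OF assms(5) c(1)]] assms(6)
      by (simp add: warped_chart_def warped_chart_axioms_def)
    have "\<exists>r>0. ball x r \<subseteq> chart_img c \<and> (\<forall>z\<in>ball x r. (f \<circ> chart_inv c) z = f p\<^sub>0)"
    proof (rule warping_function_strong_maximum[OF pos[OF c(1)]])
      show "twice_differentiable_on (chart_img c) (h \<circ> chart_inv c)"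
        by (rule smooth_on_twice_differentiable[OF smooth_fun_chart[OF assms(7) c(1)]])
      fix z assume z: "z \<in> chart_img c"
      have "0 \<le> S\<^sub>B (chart_inv c z) + lam\<^sub>F / (f (chart_inv c z))\<^sup>2 - \<rho>"
        using assms(9)[of "chart_inv c z"] by simp
      then show "0 \<le> 2 * DIM('d) * B.laplacian (f \<circ> chart_inv c) z / (f \<circ> chart_inv c) z
          + DIM('d) * (real DIM('d) - 1) * fd (f \<circ> chart_inv c) z (N z) / ((f \<circ> chart_inv c) z)\<^sup>2
          + fd (h \<circ> chart_inv c) z (N z) / (f \<circ> chart_inv c) z"
        using warped_soliton_identity[OF B(1) F(1) c(1) c'(1) z y warped_chart_axioms assms(2,4,7,8)]
        by simp
      show "(f \<circ> chart_inv c) z \<le> f p\<^sub>0" using p0 by simp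
    qed (use x \<open>p \<in> M\<close> in \<open>auto simp: M_def\<close>)
    then obtain r where r: "r > 0" "ball x r \<subseteq> chart_img c" "\<And>z. z \<in> ball x r \<Longrightarrow> f (chart_inv c z) = f p\<^sub>0"
      by auto
    define T where "T = chart_dom c \<inter> chart_map c -` ball x r"
    have "continuous_on (chart_dom c) (chart_map c)"
      using chart_homeomorphism[OF B(1) c(1)] by (simp add: homeomorphism_def)
    then have "open T"
      unfolding T_def using open_chart_dom[OF B(1) c(1)] by (intro continuous_open_preimage) auto
    moreover have "p \<in> T" using c r(1) by (simp add: T_def x_def)
    moreover have "T \<subseteq> M"
    proof
      fix t assume "t \<in> T"
      then show "t \<in> M"
        using r(3)[of "chart_map c t"] chart_inv_map[OF B(1) c(1)] by (simp add: T_def M_def)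
    qed
    ultimately show "\<exists>T. open T \<and> p \<in> T \<and> T \<subseteq> M" by blast
  qed
  moreover have "p\<^sub>0 \<in> M" by (simp add: M_def)
  ultimately have "M = UNIV"
    using connected_clopen[THEN iffD1, OF B(3), rule_format, of M] by auto
  then have "\<forall>p\<in>UNIV. f p = f p\<^sub>0" by (auto simp: M_def)
  then show ?thesis unfolding constant_on_def by (rule exI)
qed

end
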